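(* Consider any Fisher market in which all buyers have complementary-CES utility functions, or any Fisher market in which all buyers have Leontief utility functions. Let $0<\lambda\le 1/37$. Then asynchronous tatonnement price updates, starting from positive prices and using the rule $$p_j'\ =\ p_j\cdot\bigl(1+\lambda\cdot\min\{\tilde z_j,1\}\cdot(t-\alpha_j(t))\bigr)$$ for each update to a price $p_j$ at a time $t$, converge toward the market equilibrium (i.e. the distance from the price vector at time $t$ to the set of market equilibria tends to $0$ as $t\to\infty$).
   Context: Fisher market: there are $n$ goods, each with supply $1$ and each sold by its own seller who sets its price $p_j\ge 0$, and finitely many buyers; buyer $i$ has money $e_i>0$ and a utility function $u_i(x_{i1},\dots,x_{in})$. At prices $p$ each buyer buys a utility-maximizing bundle costing at most $e_i$. The demand $x_j$ for good $j$ is the total quantity sought by all buyers, and the excess demand is $z_j=x_j-1$. Prices $p^*$ form a market equilibrium if for every $j$: $p^*_j>0$ implies $z_j=0$, and $p^*_j=0$ implies $z_j\le0$. A complementary-CES utility has the form $u(x_1,\dots,x_n)=(a_1x_1^\rho+\dots+a_nx_n^\rho)^{1/\rho}$ with $\rho<0$ and $a_\ell\ge0$ (not all zero; terms with $a_\ell=0$ are omitted); parameters may differ between buyers. A Leontief utility has the form $u(x_1,\dots,x_n)=\min_{\ell\in S}\{b_\ell x_\ell\}$ with $S$ a non-empty subset of the goods and $b_\ell>0$ for $\ell\in S$ (again depending on the buyer). Asynchronous tatonnement (Ongoing market): time is continuous, starting at $0$; prices change only at update times. Sellers update their prices at arbitrary, uncoordinated times, but each price is updated at least once per unit of time ("day"),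 so successive updates to the same price are at most one time unit apart. For an update of price $j$ at time $t$, $\alpha_j(t)$ is the time of the latest update to price $j$ strictly before $t$ (or $0$ if there is none), and $\tilde z_j$ is any value between the minimum and the maximum of the instantaneous excess demand for good $j$ during the time interval $(\alpha_j(t),t)$. *)

theory Defs
  imports "HOL-Analysis.Analysis"
begin

text \<open>
  Goods are the elements of a finite type \<open>'n\<close>, so bundles and prices are vectors in
  \<open>real ^ 'n\<close>; buyers form a finite set \<open>B\<close>, with money \<open>e i\<close> and utility \<open>u i\<close>.
\<close>

subsection \<open>Utility functions\<close>

text \<open>
  Since \<open>\<rho> < 0\<close>, the term \<open>a l * 0 powr \<rho>\<close> means infinity when \<open>a l > 0\<close>, and the utility is
  then \<open>0\<close>. The library has \<open>0 powr \<rho> = 0\<close>, hence the explicit case distinction.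
\<close>

definition ces_utility :: "('n::finite \<Rightarrow> real) \<Rightarrow> real \<Rightarrow> real ^ 'n \<Rightarrow> real" where
  "ces_utility a \<rho> x =
     (if \<exists>l. a l \<noteq> 0 \<and> x $ l = 0 then 0
      else (\<Sum>l | a l \<noteq> 0. a l * (x $ l) powr \<rho>) powr (1 / \<rho>))"

definition leontief_utility :: "'n::finite set \<Rightarrow> ('n \<Rightarrow> real) \<Rightarrow> real ^ 'n \<Rightarrow> real" where
  "leontief_utility S b x = Min ((\<lambda>l. b l * x $ l) ` S)"

definition complementary_ces :: "(real ^ 'n::finite \<Rightarrow> real) \<Rightarrow> bool" where
  "complementary_ces u \<longleftrightarrow>
     (\<exists>a \<rho>. \<rho> < 0 \<and> (\<forall>l. 0 \<le> a l) \<and> (\<exists>l. a l \<noteq> 0) \<and>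
        (\<forall>x. (\<forall>l. 0 \<le> x $ l) \<longrightarrow> u x = ces_utility a \<rho> x))"

definition leontief :: "(real ^ 'n::finite \<Rightarrow> real) \<Rightarrow> bool" where
  "leontief u \<longleftrightarrow>
     (\<exists>S b. S \<noteq> {} \<and> (\<forall>l\<in>S. 0 < b l) \<and>
        (\<forall>x. (\<forall>l. 0 \<le> x $ l) \<longrightarrow> u x = leontief_utility S b x))"

subsection \<open>Demand and equilibrium\<close>

definition budget_set :: "real ^ 'n::finite \<Rightarrow> real \<Rightarrow> (real ^ 'n) set" where
  "budget_set p m = {x. (\<forall>l. 0 \<le> x $ l) \<and> p \<bullet> x \<le> m}"

definition optimal_bundles ::
    "(real ^ 'n::finite \<Rightarrow> real) \<Rightarrow> real \<Rightarrow> real ^ 'n \<Rightarrow> (real ^ 'n) set" where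
  "optimal_bundles u m p = {x \<in> budget_set p m. \<forall>y \<in> budget_set p m. u y \<le> u x}"

text \<open>
  Excess demand is set-valued: for the utilities above it is a singleton at positive prices, but
  at a zero price an optimal bundle may fail to be unique, or to exist.
\<close>

definition excess_demands ::
    "'b set \<Rightarrow> ('b \<Rightarrow> real) \<Rightarrow> ('b \<Rightarrow> real ^ 'n::finite \<Rightarrow> real) \<Rightarrow> real ^ 'n \<Rightarrow> (real ^ 'n) set"
  where
  "excess_demands B e u p =
     {z. \<exists>x. (\<forall>i\<in>B. x i \<in> optimal_bundles (u i) (e i) p) \<and>
             (\<forall>j. z $ j = (\<Sum>i\<in>B. x i $ j) - 1)}"

definition market_equilibria ::
    "'b set \<Rightarrow> ('b \<Rightarrow> real) \<Rightarrow> ('b \<Rightarrow> real ^ 'n::finite \<Rightarrow> real) \<Rightarrow> (real ^ 'n) set" where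
  "market_equilibria B e u =
     {p. (\<forall>j. 0 \<le> p $ j) \<and>
         (\<exists>z \<in> excess_demands B e u p.
            \<forall>j. (p $ j > 0 \<longrightarrow> z $ j = 0) \<and> (p $ j = 0 \<longrightarrow> z $ j \<le> 0))}"

subsection \<open>Asynchronous price updates\<close>

definition last_update :: "real set \<Rightarrow> real \<Rightarrow> real" where
  "last_update V t = (if V \<inter> {..<t} = {} then 0 else Max (V \<inter> {..<t}))"

text \<open>
  \<open>U j\<close> is the set of update times of price \<open>j\<close>, \<open>zt j t\<close> the excess demand estimate used by
  the update at time \<open>t\<close>, and \<open>p t\<close> the price vector at time \<open>t\<close> after any updates taking
  place at \<open>t\<close>; thus price \<open>j\<close> just before an update at \<open>t\<close> is
  \<open>p (last_update (U j) t) $ j\<close>. Local finiteness is implicit in speaking of the latest update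
  before \<open>t\<close>. It makes prices piecewise constant, so that, demand at positive prices being
  unique, the sets of which \<open>Min\<close> and \<open>Max\<close> are taken are finite and nonempty.
\<close>

locale asynchronous_tatonnement =
  fixes B :: "'b set"
    and e :: "'b \<Rightarrow> real"
    and u :: "'b \<Rightarrow> real ^ 'n::finite \<Rightarrow> real"
    and lam :: real
    and U :: "'n \<Rightarrow> real set"
    and zt :: "'n \<Rightarrow> real \<Rightarrow> real"
    and p :: "real \<Rightarrow> real ^ 'n"
  assumes update_pos: "U j \<subseteq> {0<..}"
    and update_locally_finite: "finite (U j \<inter> {..T})"
    and update_daily: "0 \<le> t \<Longrightarrow> U j \<inter> {t<..t + 1} \<noteq> {}"
    and initial_pos: "0 < p 0 $ j"
    and price_constant: "\<lbrakk>0 \<le> s; s \<le> t; U j \<inter> {s<..t} = {}\<rbrakk> \<Longrightarrow> p t $ j = p s $ j"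
    and zt_lower: "t \<in> U j \<Longrightarrow>
      Min {z $ j | z s. s \<in> {last_update (U j) t<..<t} \<and> z \<in> excess_demands B e u (p s)} \<le> zt j t"
    and zt_upper: "t \<in> U j \<Longrightarrow>
      zt j t \<le> Max {z $ j | z s. s \<in> {last_update (U j) t<..<t} \<and> z \<in> excess_demands B e u (p s)}"
    and update: "t \<in> U j \<Longrightarrow>
      p t $ j = p (last_update (U j) t) $ j *
        (1 + lam * min (zt j t) 1 * (t - last_update (U j) t))"

end

theory Submission
  imports Defs
begin

text \<open>
  CES and Leontief demand have the common form
  \<open>x\<^sub>j = e w\<^sub>j p\<^sub>j powr (c - 1) / (\<Sum>k. w\<^sub>k p\<^sub>k powr c)\<close> with \<open>0 < c \<le> 1\<close>, and excess demand is
  the negative gradient of the convex potential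
  \<open>\<phi> p = (\<Sum>j. p\<^sub>j) - (\<Sum>i. e\<^sub>i / c\<^sub>i ln (\<Sum>k. w\<^sub>i\<^sub>k p\<^sub>k powr c\<^sub>i))\<close>. An update with the exact excess demand
  lowers \<open>\<phi>\<close> by a gain that dominates the second-order term. The error of the estimate used
  for price \<open>j\<close> is a sum over the updates of other prices \<open>k\<close> since the last update of \<open>j\<close>;
  by the AM-GM inequality each such pair is charged half to either update, and since the
  spending shares sum to one and change little within a day, all charges together are at most
  half of the gains when \<open>\<lambda> \<le> 1/37\<close>. Hence \<open>\<phi>\<close> stays below its initial value, prices stay bounded,
  and the gains are summable.

  Summability makes the prices move slowly, and at every limit point goods with a positive
  price have zero excess demand. If all \<open>c < 1\<close>, prices of desired goods stay away from zero
  and limit points are equilibria. If all \<open>c = 1\<close>, the demand at a limit point is determined by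
  its support, so it takes finitely many values; as the demand moves slowly, a good with price
  limit zero and positive excess demand would have positive excess demand forever, so that its
  price could not tend to zero.
\<close>

subsection \<open>Individual demand\<close>

text \<open>The obstacle is stale information: an update of price \<open>j\<close> uses demand from
  any moment since its last update, while its effect on the potential depends on demand now. During
  that interval price \<open>j\<close> itself is fixed, so demand for \<open>j\<close> moves only
  through the buyers' price indices. This drift is of first order in the relative changes of the
  other prices, with coefficients \<open>joint_share\<close> whose row sums are the spending on
  \<open>j\<close>. The resulting error in the potential is a product of two relative changes, hence
  of the order of the second-order term. The truncation at 1 bounds a relative change by
  \<open>lam\<close> and keeps the second-order term proportional to the gain when excess demand is
  large. With \<open>lam\<close> at most 1/37 an update moves a logarithmic price by at most 1/36;
  with daily updates this makes prices and shares comparable over a day. Equilibria need not be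
  unique, so the target is the set of equilibria, and its nonemptiness is a by-product. CES demand
  for a desired good blows up as its price tends to zero while Leontief demand may stay finite,
  which forces separate arguments at zero prices.\<close>

definition price_index :: "('n::finite \<Rightarrow> real) \<Rightarrow> real \<Rightarrow> real ^ 'n \<Rightarrow> real" where
  "price_index w c p = (\<Sum>k\<in>UNIV. w k * (p $ k) powr c)"

definition budget_share :: "('n::finite \<Rightarrow> real) \<Rightarrow> real \<Rightarrow> real ^ 'n \<Rightarrow> 'n \<Rightarrow> real" where
  "budget_share w c p j = w j * (p $ j) powr c / price_index w c p"

text \<open>
  A CES buyer with coefficients \<open>a\<close> and exponent \<open>\<rho>\<close> has \<open>c = \<rho> / (\<rho> - 1)\<close> and \<open>w l = a l powr (1 - c)\<close>;
  a Leontief buyer is the limit case \<open>c = 1\<close>, \<open>w l = 1 / b l\<close>. It is treated separately because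
  \<open>0 powr 0 = 0\<close>, whereas Leontief demand for a free good is positive.
\<close>

definition demand :: "('n::finite \<Rightarrow> real) \<Rightarrow> real \<Rightarrow> real \<Rightarrow> real ^ 'n \<Rightarrow> 'n \<Rightarrow> real" where
  "demand w c m p j =
     m * w j * (if c = 1 then 1 else (p $ j) powr (c - 1)) / price_index w c p"

lemma price_index_nonneg: "(\<And>k. 0 \<le> w k) \<Longrightarrow> 0 \<le> price_index w c p"
  unfolding price_index_def by (intro sum_nonneg mult_nonneg_nonneg) auto

lemma price_index_pos:
  assumes "\<And>k. 0 \<le> w k" "0 < w k" "0 < p $ k"
  shows "0 < price_index w c p"
proof -
  have "0 < w k * (p $ k) powr c" using assms by simp
  also have "\<dots> \<le> price_index w c p"
    unfolding price_index_def
    by (rule member_le_sum) (use assms in auto)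
  finally show ?thesis .
qed

lemma demand_nonneg:
  assumes "\<And>k. 0 \<le> w k" "0 \<le> m"
  shows "0 \<le> demand w c m p j"
  unfolding demand_def
  by (intro divide_nonneg_nonneg mult_nonneg_nonneg price_index_nonneg) (use assms in auto)

lemma price_times_demand:
  assumes "0 \<le> p $ j" "w j \<noteq> 0 \<Longrightarrow> c \<noteq> 1 \<Longrightarrow> 0 < p $ j"
  shows "p $ j * demand w c m p j = m * budget_share w c p j"
proof (cases "c = 1 \<or> w j = 0")
  case True
  then show ?thesis using assms by (auto simp: demand_def budget_share_def)
next
  case False
  then have "0 < p $ j" using assms by auto
  then have "p $ j * (p $ j) powr (c - 1) = (p $ j) powr c"
    by (simp add: powr_mult_base)
  then show ?thesis using False
    by (simp add: demand_def budget_share_def field_simps) 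
qed

lemma sum_budget_share: "price_index w c p \<noteq> 0 \<Longrightarrow> (\<Sum>j\<in>UNIV. budget_share w c p j) = 1"
  unfolding budget_share_def sum_divide_distrib[symmetric] price_index_def by simp

section \<open>Optimality and uniqueness of CES and Leontief demand\<close>

lemma optimal_bundles_cong:
  assumes "\<And>x. (\<forall>l. 0 \<le> x $ l) \<Longrightarrow> u x = v x"
  shows "optimal_bundles u m p = optimal_bundles v m p"
  using assms unfolding optimal_bundles_def budget_set_def by auto

text \<open>Convexity of \<open>t powr r\<close> at 1, obtained by chaining the tangent bounds of
  \<open>exp\<close> and \<open>ln\<close>. The equality case is what yields uniqueness of the
  optimal CES bundle.\<close>

lemma powr_tangent:
  fixes t r :: real
  assumes "0 < t" "r < 0"
  shows "1 + r * (t - 1) \<le> t powr r"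
    and "t powr r = 1 + r * (t - 1) \<Longrightarrow> t = 1"
proof -
  have 1: "1 + r * ln t \<le> t powr r"
    using assms exp_ge_add_one_self[of "r * ln t"] by (simp add: powr_def)
  have 2: "r * (t - 1) \<le> r * ln t"
    using assms ln_le_minus_one[of t] by (intro mult_left_mono_neg) auto
  show "1 + r * (t - 1) \<le> t powr r" using 1 2 by linarith
  assume "t powr r = 1 + r * (t - 1)"
  then have "r * (t - 1) = r * ln t" using 1 2 by linarith
  then show "t = 1" using assms ln_eq_minus_one[of t] by simp
qed

text \<open>As \<rho> < 0, maximizing the utility means minimizing the convex sum \<open>F\<close>
  over the budget set, so the first-order condition at \<open>x\<close> together with the tangent
  inequality gives optimality. Uniqueness asks for positive prices, since a free good that the buyer
  does not want can be added in any amount.\<close>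

lemma ces_optimal:
  fixes a :: "'n::finite \<Rightarrow> real"
  assumes rho: "\<rho> < 0" and a: "\<And>l. 0 \<le> a l" "a l0 \<noteq> 0" and m: "0 < m"
    and p: "\<And>l. 0 \<le> p $ l" "\<And>l. a l \<noteq> 0 \<Longrightarrow> 0 < p $ l"
    and c_def: "c = \<rho> / (\<rho> - 1)" and w_def: "\<And>l. w l = a l powr (1 - c)"
  defines "x \<equiv> \<chi> j. demand w c m p j"
  shows "x \<in> optimal_bundles (ces_utility a \<rho>) m p"
    and "(\<And>l. 0 < p $ l) \<Longrightarrow> y \<in> optimal_bundles (ces_utility a \<rho>) m p \<Longrightarrow> y = x"
proof -
  have c: "0 < c" "c < 1" using rho by (auto simp: c_def field_simps)
  have w0: "w l = 0 \<longleftrightarrow> a l = 0" for l by (simp add: w_def)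
  have w: "0 \<le> w l" for l by (simp add: w_def)
  let ?G = "price_index w c p"
  have wpos: "0 < w l0" using w0[of l0] w[of l0] a(2) by linarith
  have G: "0 < ?G" using price_index_pos[of w l0 p c] w wpos p(2)[OF a(2)] by blast
  have x0: "x $ l = 0" if "a l = 0" for l
    using that w0[of l] by (simp add: x_def demand_def)
  have xpos: "0 < x $ l" if "a l \<noteq> 0" for l
  proof -
    have "0 < w l" using w0[of l] w[of l] that by linarith
    then show ?thesis using c m G p(2)[OF that] by (simp add: x_def demand_def)
  qed
  have px: "p \<bullet> x = m"
  proof -
    have "p \<bullet> x = (\<Sum>j\<in>UNIV. m * budget_share w c p j)"
      unfolding inner_vec_def x_def
      by (rule sum.cong) (use price_times_demand[OF p(1), of w] p w0 in auto)
    also have "\<dots> = m" using sum_budget_share[of w c p] G by (simp add: sum_distrib_left[symmetric])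
    finally show ?thesis .
  qed
  have xb: "x \<in> budget_set p m"
  proof -
    have "0 \<le> x $ l" for l using x0[of l] xpos[of l] by (cases "a l = 0") auto
    then show ?thesis using px by (simp add: budget_set_def)
  qed
  define F where "F = (\<lambda>y :: real ^ 'n. \<Sum>l | a l \<noteq> 0. a l * (y $ l) powr \<rho>)"
  have Fpos: "0 < F y" if "\<And>l. a l \<noteq> 0 \<Longrightarrow> y $ l \<noteq> 0" for y
  proof -
    have "0 < a l * (y $ l) powr \<rho>" if l: "a l \<noteq> 0" for l
      using a(1)[of l] that \<open>\<And>l. a l \<noteq> 0 \<Longrightarrow> y $ l \<noteq> 0\<close>[OF l] by simp
    then show ?thesis unfolding F_def using a(2) by (intro sum_pos) auto
  qed
  \<comment> \<open>The multiplier of the budget constraint: the first-order condition is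
    \<open>a l * x l powr (\<rho> - 1) = \<kappa> * p l\<close>, used below after multiplication by
    \<open>x l\<close>.\<close>
  define \<kappa> where "\<kappa> = (m / ?G) powr (\<rho> - 1)"
  have kpos: "0 < \<kappa>" using m G by (simp add: \<kappa>_def)
  have grad: "a l * (x $ l) powr \<rho> = \<kappa> * (p $ l * x $ l)" if "a l \<noteq> 0" for l
  proof -
    have al: "0 < a l" using a(1)[of l] that by linarith
    have pl: "0 < p $ l" using p(2)[OF that] .
    have e1: "(1 - c) * (\<rho> - 1) = -1" using rho by (simp add: c_def field_simps)
    have e2: "(c - 1) * (\<rho> - 1) = 1" using rho by (simp add: c_def field_simps)
    have "x $ l = m / ?G * (a l powr (1 - c) * (p $ l) powr (c - 1))"
      using c by (simp add: x_def demand_def w_def)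
    moreover have "(A * (u * v)) powr r = A powr r * (u powr r * v powr r)"
      if "0 \<le> A" "0 \<le> u" "0 \<le> v" for A u v r :: real
      using that by (simp add: powr_mult)
    ultimately have "(x $ l) powr (\<rho> - 1) =
        \<kappa> * ((a l powr (1 - c)) powr (\<rho> - 1) * ((p $ l) powr (c - 1)) powr (\<rho> - 1))"
      using m G unfolding \<kappa>_def by (metis divide_nonneg_pos less_imp_le powr_ge_zero)
    also have "\<dots> = \<kappa> * (p $ l / a l)"
      unfolding powr_powr e1 e2 using al pl by (simp add: powr_minus field_simps)
    finally have "a l * (x $ l) powr (\<rho> - 1) = \<kappa> * p $ l" using al by simp
    moreover have "(x $ l) powr \<rho> = (x $ l) powr (\<rho> - 1) * x $ l"
      using xpos[OF that] by (metis powr_mult_base mult.commute diff_add_cancel less_le add.commute)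
    ultimately show ?thesis by (simp add: mult_ac)
  qed
  have main: "F x \<le> F y" "F y = F x \<Longrightarrow> (\<And>l. a l \<noteq> 0 \<Longrightarrow> y $ l = x $ l)"
    if y: "y \<in> budget_set p m" and ypos: "\<And>l. a l \<noteq> 0 \<Longrightarrow> 0 < y $ l" for y
  proof -
    \<comment> \<open>The distance of a term of \<open>F\<close> from its tangent at
      \<open>x\<close>. The tangents sum to a multiple of the difference in spending, so the budget
      constraint bounds the sum of all \<open>D l\<close> by \<open>F y - F x\<close>.\<close>
    define D where "D = (\<lambda>l. a l * (y $ l) powr \<rho> - (a l * (x $ l) powr \<rho> + \<rho> * \<kappa> * (p $ l * y $ l - p $ l * x $ l)))"
    have scale: "D l = a l * (x $ l) powr \<rho> * ((y $ l / x $ l) powr \<rho> - (1 + \<rho> * (y $ l / x $ l - 1)))"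
      if l: "a l \<noteq> 0" for l
    proof -
      have e1: "a l * (y $ l) powr \<rho> = a l * (x $ l) powr \<rho> * (y $ l / x $ l) powr \<rho>"
        using xpos[OF l] ypos[OF l] by (simp add: powr_divide)
      have e2: "\<rho> * \<kappa> * (p $ l * y $ l - p $ l * x $ l)
          = a l * (x $ l) powr \<rho> * (\<rho> * (y $ l / x $ l - 1))"
        unfolding grad[OF l] using xpos[OF l] by (simp add: field_simps)
      show ?thesis unfolding D_def e1 e2
        by (simp only: right_diff_distrib distrib_left mult_1_right)
    qed
    have D0: "0 \<le> D l" if l: "a l \<noteq> 0" for l
      unfolding scale[OF l]
      using powr_tangent(1)[of "y $ l / x $ l" \<rho>] xpos[OF l] ypos[OF l] rho a(1)[of l]
      by (intro mult_nonneg_nonneg) auto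
    have Deq: "y $ l = x $ l" if l: "a l \<noteq> 0" and "D l = 0" for l
    proof -
      have "(y $ l / x $ l) powr \<rho> = 1 + \<rho> * (y $ l / x $ l - 1)"
        using that(2) l xpos[OF l] unfolding scale[OF l] by simp
      then have "y $ l / x $ l = 1"
        using powr_tangent(2)[of "y $ l / x $ l" \<rho>] xpos[OF l] ypos[OF l] rho by auto
      then show ?thesis using xpos[OF l] by (simp add: field_simps)
    qed
    have "(\<Sum>l | a l \<noteq> 0. p $ l * y $ l) \<le> p \<bullet> y"
      unfolding inner_vec_def inner_real_def
      using y p(1) by (intro sum_mono2) (auto simp: budget_set_def)
    also have "\<dots> \<le> m" using y by (simp add: budget_set_def)
    finally have py: "(\<Sum>l | a l \<noteq> 0. p $ l * y $ l) \<le> m" .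
    have px': "(\<Sum>l | a l \<noteq> 0. p $ l * x $ l) = m"
    proof -
      have "(\<Sum>l | a l \<noteq> 0. p $ l * x $ l) = p \<bullet> x"
        unfolding inner_vec_def inner_real_def by (rule sum.mono_neutral_left) (auto simp: x0)
      then show ?thesis using px by simp
    qed
    have "(\<Sum>l | a l \<noteq> 0. D l) = F y - (F x + \<rho> * \<kappa> * ((\<Sum>l | a l \<noteq> 0. p $ l * y $ l) - m))"
      unfolding D_def F_def px'[symmetric]
      by (simp add: sum_subtractf sum.distrib sum_distrib_left[symmetric])
    moreover have "0 \<le> \<rho> * \<kappa> * ((\<Sum>l | a l \<noteq> 0. p $ l * y $ l) - m)"
      using py rho kpos by (intro mult_nonpos_nonpos) (auto intro!: mult_nonpos_nonneg)
    ultimately have S: "(\<Sum>l | a l \<noteq> 0. D l) \<le> F y - F x" by linarith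
    have S0: "0 \<le> (\<Sum>l | a l \<noteq> 0. D l)" by (intro sum_nonneg) (use D0 in auto)
    show "F x \<le> F y" using S S0 by linarith
    show "y $ l = x $ l" if "F y = F x" "a l \<noteq> 0" for l
    proof -
      have "(\<Sum>l | a l \<noteq> 0. D l) = 0" using S S0 that by linarith
      then have "D l = 0" using D0 that(2) by (subst (asm) sum_nonneg_eq_0_iff) auto
      then show ?thesis using Deq that(2) by blast
    qed
  qed
  have ux: "ces_utility a \<rho> x = F x powr (1 / \<rho>)"
    using xpos by (force simp: ces_utility_def F_def)
  have uxpos: "0 < ces_utility a \<rho> x"
    using Fpos[of x] xpos unfolding ux by (metis powr_gt_zero less_irrefl)
  have ypos: "0 < y $ l" if "y \<in> budget_set p m" "\<not> (\<exists>l. a l \<noteq> 0 \<and> y $ l = 0)" "a l \<noteq> 0" for y l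
    using that by (auto simp: budget_set_def less_le)
  have opt: "ces_utility a \<rho> y \<le> ces_utility a \<rho> x" if y: "y \<in> budget_set p m" for y
  proof (cases "\<exists>l. a l \<noteq> 0 \<and> y $ l = 0")
    case True
    then show ?thesis using uxpos by (simp add: ces_utility_def)
  next
    case False
    then have "F x \<le> F y" using main(1)[OF y] ypos[OF y] by blast
    then have "F y powr (1 / \<rho>) \<le> F x powr (1 / \<rho>)"
      using Fpos[of x] xpos rho by (intro powr_mono2') (auto simp: less_le)
    then show ?thesis unfolding ux using False by (simp add: ces_utility_def F_def)
  qed
  show "x \<in> optimal_bundles (ces_utility a \<rho>) m p"
    using xb opt by (auto simp: optimal_bundles_def)
  assume pp: "\<And>l. 0 < p $ l" and yo: "y \<in> optimal_bundles (ces_utility a \<rho>) m p"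
  then have y: "y \<in> budget_set p m" and "ces_utility a \<rho> x \<le> ces_utility a \<rho> y"
    using xb by (auto simp: optimal_bundles_def)
  then have eq: "ces_utility a \<rho> y = ces_utility a \<rho> x" using opt[OF y] by linarith
  have nz: "\<not> (\<exists>l. a l \<noteq> 0 \<and> y $ l = 0)"
  proof
    assume "\<exists>l. a l \<noteq> 0 \<and> y $ l = 0"
    then have "ces_utility a \<rho> y = 0" by (simp add: ces_utility_def)
    then show False using eq uxpos by simp
  qed
  have "F y powr (1 / \<rho>) = F x powr (1 / \<rho>)"
    using eq nz unfolding ux by (simp add: ces_utility_def F_def)
  then have "(F y powr (1 / \<rho>)) powr \<rho> = (F x powr (1 / \<rho>)) powr \<rho>" by simp
  then have "F y = F x"
    using rho Fpos[of x] Fpos[of y] xpos ypos[OF y nz] unfolding powr_powr by (auto simp: less_le)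
  then have yx: "y $ l = x $ l" if "a l \<noteq> 0" for l using main(2)[OF y] ypos[OF y nz] that by blast
  \<comment> \<open>Desired goods already agree and \<open>x\<close> contains nothing else. As
    \<open>x\<close> exhausts the budget, any surplus in \<open>y\<close> would have to be
    free.\<close>
  have le: "x $ l \<le> y $ l" for l
    using yx[of l] x0[of l] y by (cases "a l = 0") (auto simp: budget_set_def)
  have "(\<Sum>l\<in>UNIV. p $ l * (y $ l - x $ l)) \<le> 0"
    using y px by (simp add: budget_set_def inner_vec_def right_diff_distrib sum_subtractf)
  moreover have "0 \<le> p $ l * (y $ l - x $ l)" for l using le[of l] p(1)[of l] by simp
  ultimately have "\<forall>l. p $ l * (y $ l - x $ l) = 0"
    using sum_nonneg_eq_0_iff[of UNIV "\<lambda>l. p $ l * (y $ l - x $ l)"]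
      sum_nonneg[of UNIV "\<lambda>l. p $ l * (y $ l - x $ l)"] by auto
  then show "y = x" using pp by (auto simp: vec_eq_iff less_le)
qed

text \<open>Reaching utility \<open>v\<close> takes at least \<open>v * w l\<close> of each good, so
  the index is the price of one unit of utility. No division by single prices occurs, so a positive
  index is enough for optimality even when some prices vanish.\<close>

lemma leontief_optimal:
  fixes b :: "'n::finite \<Rightarrow> real"
  assumes S: "S \<noteq> {}" and b: "\<And>l. l \<in> S \<Longrightarrow> 0 < b l" and m: "0 < m"
    and p: "\<And>l. 0 \<le> p $ l" and w_def: "\<And>l. w l = (if l \<in> S then 1 / b l else 0)"
    and G: "0 < price_index w 1 p"
  defines "x \<equiv> \<chi> j. demand w 1 m p j"
  shows "x \<in> optimal_bundles (leontief_utility S b) m p"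
    and "(\<And>l. 0 < p $ l) \<Longrightarrow> y \<in> optimal_bundles (leontief_utility S b) m p \<Longrightarrow> y = x"
proof -
  let ?G = "price_index w 1 p"
  have fS: "finite S" by simp
  have x: "x $ l = (if l \<in> S then m / ?G / b l else 0)" for l
    by (simp add: x_def demand_def w_def)
  have Geq: "?G = (\<Sum>l\<in>UNIV. w l * p $ l)" using p by (simp add: price_index_def)
  have px: "p \<bullet> x = m"
  proof -
    have "p \<bullet> x = (\<Sum>l\<in>UNIV. m / ?G * (w l * p $ l))"
      unfolding inner_vec_def by (rule sum.cong) (auto simp: x w_def mult_ac)
    also have "\<dots> = m" using G unfolding sum_distrib_left[symmetric] Geq by simp
    finally show ?thesis .
  qed
  have x0: "0 \<le> x $ l" for l
    using m G less_imp_le[OF b[of l]] by (cases "l \<in> S") (simp_all add: x)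
  have xb: "x \<in> budget_set p m" using x0 px by (simp add: budget_set_def)
  have ux: "leontief_utility S b x = m / ?G"
  proof -
    have "(\<lambda>l. b l * x $ l) ` S = (\<lambda>l. m / ?G) ` S"
      by (rule image_cong) (auto simp: x less_imp_neq[OF b, symmetric])
    then show ?thesis using S by (simp add: leontief_utility_def)
  qed
  have low: "leontief_utility S b y * w l \<le> y $ l" if "y \<in> budget_set p m" for y l
  proof (cases "l \<in> S")
    case True
    then have "leontief_utility S b y \<le> b l * y $ l" by (simp add: leontief_utility_def)
    then show ?thesis using True b[OF True] by (simp add: w_def field_simps)
  next
    case False
    then show ?thesis using that by (simp add: w_def budget_set_def)
  qed
  have opt: "leontief_utility S b y \<le> m / ?G" if y: "y \<in> budget_set p m" for y
  proof -
    have "leontief_utility S b y * ?G = (\<Sum>l\<in>UNIV. p $ l * (leontief_utility S b y * w l))"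
      unfolding Geq sum_distrib_left by (rule sum.cong) auto
    also have "\<dots> \<le> (\<Sum>l\<in>UNIV. p $ l * y $ l)"
      by (intro sum_mono mult_left_mono low[OF y] p)
    also have "\<dots> \<le> m" using y by (simp add: budget_set_def inner_vec_def)
    finally show ?thesis using G by (simp add: field_simps)
  qed
  show "x \<in> optimal_bundles (leontief_utility S b) m p"
    using xb opt ux by (auto simp: optimal_bundles_def)
  assume pp: "\<And>l. 0 < p $ l" and yo: "y \<in> optimal_bundles (leontief_utility S b) m p"
  then have y: "y \<in> budget_set p m" and "leontief_utility S b x \<le> leontief_utility S b y"
    using xb by (auto simp: optimal_bundles_def)
  then have eq: "leontief_utility S b y = m / ?G" using opt[OF y] ux by linarith
  have le: "x $ l \<le> y $ l" for l
    using low[OF y, of l] unfolding eq by (simp add: x w_def mult.commute split: if_splits)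
  have "(\<Sum>l\<in>UNIV. p $ l * (y $ l - x $ l)) \<le> 0"
    using y px by (simp add: budget_set_def inner_vec_def right_diff_distrib sum_subtractf)
  moreover have "0 \<le> p $ l * (y $ l - x $ l)" for l using le[of l] p[of l] by simp
  ultimately have "\<forall>l. p $ l * (y $ l - x $ l) = 0"
    using sum_nonneg_eq_0_iff[of UNIV "\<lambda>l. p $ l * (y $ l - x $ l)"]
      sum_nonneg[of UNIV "\<lambda>l. p $ l * (y $ l - x $ l)"] by auto
  then show "y = x" using pp by (auto simp: vec_eq_iff less_le)
qed

text \<open>The two clauses serve different ends. Uniqueness at positive prices turns the set-valued
  excess demand along the trajectory into a function; mere optimality at possibly zero prices is
  what certifies a limit point as an equilibrium.\<close>

definition has_ces_demand :: "('n::finite \<Rightarrow> real) \<Rightarrow> real \<Rightarrow> (real ^ 'n \<Rightarrow> real) \<Rightarrow> bool" where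
  "has_ces_demand w c u \<longleftrightarrow> 0 < c \<and> c \<le> 1 \<and> (\<forall>l. 0 \<le> w l) \<and> (\<exists>l. 0 < w l) \<and>
     (\<forall>m p. 0 < m \<and> (\<forall>l. 0 \<le> p $ l) \<and> 0 < price_index w c p \<and>
          (c < 1 \<longrightarrow> (\<forall>l. 0 < w l \<longrightarrow> 0 < p $ l)) \<longrightarrow>
        (\<chi> j. demand w c m p j) \<in> optimal_bundles u m p) \<and>
     (\<forall>m p. 0 < m \<and> (\<forall>l. 0 < p $ l) \<longrightarrow>
        optimal_bundles u m p = {\<chi> j. demand w c m p j})"

lemma complementary_ces_has_ces_demand:
  assumes "complementary_ces u"
  shows "\<exists>w c. c < 1 \<and> has_ces_demand w c u"
proof -
  obtain a \<rho> l0 where rho: "\<rho> < 0" and a: "\<And>l. 0 \<le> a l" "a l0 \<noteq> 0"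
    and u: "\<And>x. (\<forall>l. 0 \<le> x $ l) \<Longrightarrow> u x = ces_utility a \<rho> x"
    using assms unfolding complementary_ces_def by blast
  define c where "c = \<rho> / (\<rho> - 1)"
  define w where "w = (\<lambda>l. a l powr (1 - c))"
  have c: "0 < c" "c < 1" using rho by (auto simp: c_def field_simps)
  have wpos: "0 < w l \<longleftrightarrow> a l \<noteq> 0" for l by (simp add: w_def)
  have eq: "optimal_bundles u m p = optimal_bundles (ces_utility a \<rho>) m p" for m p
    by (rule optimal_bundles_cong) (rule u)
  have "(\<chi> j. demand w c m p j) \<in> optimal_bundles u m p"
    if "0 < m" "\<forall>l. 0 \<le> p $ l" "\<forall>l. 0 < w l \<longrightarrow> 0 < p $ l" for m and p :: "real ^ 'a"
    unfolding eq
    by (rule ces_optimal(1)[of \<rho> a l0]) (use that rho a wpos in \<open>auto simp: c_def w_def\<close>)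
  moreover have "y = (\<chi> j. demand w c m p j)"
    if "0 < m" "\<forall>l. 0 < p $ l" "y \<in> optimal_bundles u m p" for m and p y :: "real ^ 'a"
    by (rule ces_optimal(2)[of \<rho> a l0])
      (use that rho a wpos in \<open>auto simp: c_def w_def eq intro: less_imp_le\<close>)
  moreover from calculation(1) have "(\<chi> j. demand w c m p j) \<in> optimal_bundles u m p"
    if "0 < m" "\<forall>l. 0 < p $ l" for m and p :: "real ^ 'a"
    using that by (simp add: less_imp_le)
  ultimately have "has_ces_demand w c u"
    unfolding has_ces_demand_def using c wpos a(2) by (fastforce simp: w_def)
  then show ?thesis using c by blast
qed

lemma leontief_has_ces_demand:
  assumes "leontief u"
  shows "\<exists>w. has_ces_demand w 1 u"
proof -
  obtain S b where S: "S \<noteq> {}" and b: "\<And>l. l \<in> S \<Longrightarrow> 0 < b l"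
    and u: "\<And>x. (\<forall>l. 0 \<le> x $ l) \<Longrightarrow> u x = leontief_utility S b x"
    using assms unfolding leontief_def by blast
  define w where "w = (\<lambda>l. if l \<in> S then 1 / b l else 0)"
  have w: "0 \<le> w l" for l using b[of l] by (auto simp: w_def)
  obtain l0 where "l0 \<in> S" using S by blast
  then have l0: "0 < w l0" using b[of l0] by (simp add: w_def)
  have eq: "optimal_bundles u m p = optimal_bundles (leontief_utility S b) m p" for m p
    by (rule optimal_bundles_cong) (rule u)
  have 1: "(\<chi> j. demand w 1 m p j) \<in> optimal_bundles u m p"
    if "0 < m" "\<forall>l. 0 \<le> p $ l" "0 < price_index w 1 p" for m and p :: "real ^ 'a"
    unfolding eq
    by (rule leontief_optimal(1)[of S b]) (use that S b in \<open>auto simp: w_def\<close>)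
  have 2: "y = (\<chi> j. demand w 1 m p j)"
    if "0 < m" "\<forall>l. 0 < p $ l" "y \<in> optimal_bundles u m p" for m and p y :: "real ^ 'a"
    by (rule leontief_optimal(2)[of S b])
      (use that S b price_index_pos[of w l0 p, OF w l0] in \<open>auto simp: w_def eq intro: less_imp_le\<close>)
  have "(\<chi> j. demand w 1 m p j) \<in> optimal_bundles u m p"
    if "0 < m" "\<forall>l. 0 < p $ l" for m and p :: "real ^ 'a"
    using 1[of m p] that price_index_pos[of w l0 p, OF w l0] by (simp add: less_imp_le)
  then have "has_ces_demand w 1 u"
    unfolding has_ces_demand_def using w l0 1 2 by fastforce
  then show ?thesis by blast
qed

subsection \<open>Step functions and update times\<close>

text \<open>Telescoping for a step function \<open>f\<close> with jumps in \<open>F\<close>, where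
  \<open>g t\<close> stands for the left limit at a jump. The induction splits off the last jump;
  \<open>b'\<close> is a point before it and not before any earlier one.\<close>

lemma sum_jumps:
  fixes f g :: "real \<Rightarrow> real"
  assumes "finite F" "a \<le> b" "F \<subseteq> {a<..b}"
    and "\<And>s t. a \<le> s \<Longrightarrow> s \<le> t \<Longrightarrow> t \<le> b \<Longrightarrow> F \<inter> {s<..t} = {} \<Longrightarrow> f s = f t"
    and "\<And>s t. a \<le> s \<Longrightarrow> s < t \<Longrightarrow> t \<in> F \<Longrightarrow> F \<inter> {s<..<t} = {} \<Longrightarrow> f s = g t"
  shows "f b - f a = (\<Sum>t\<in>F. f t - g t)"
  using assms
proof (induction "card F" arbitrary: F b)
  case 0
  then have "F = {}" by simp
  then show ?case using 0 by auto
next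
  case (Suc n)
  define M where "M = Max F"
  have M: "M \<in> F" "\<And>t. t \<in> F \<Longrightarrow> t \<le> M"
    using Suc(2,3) unfolding M_def by (auto intro!: Max_in)
  define F' where "F' = F - {M}"
  obtain b' where b': "a \<le> b'" "b' < M" "F' \<subseteq> {a<..b'}"
  proof (cases "F' = {}")
    case True
    then show ?thesis using that[of a] M Suc.prems by auto
  next
    case False
    have "finite F'" using Suc.prems(1) by (simp add: F'_def)
    then have "Max F' \<in> F'" "\<And>t. t \<in> F' \<Longrightarrow> t \<le> Max F'"
      using False by (auto intro: Max_in)
    moreover have "Max F' < M" using calculation M by (force simp: F'_def)
    ultimately show ?thesis using that[of "Max F'"] Suc.prems(3) by (force simp: F'_def)
  qed
  have "f b' - f a = (\<Sum>t\<in>F'. f t - g t)"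
  proof (rule Suc.hyps(1))
    show "n = card F'" using Suc(2) M Suc.prems(1) by (simp add: F'_def)
    show "finite F'" using Suc.prems(1) by (simp add: F'_def)
    show "f s = f t" if "a \<le> s" "s \<le> t" "t \<le> b'" "F' \<inter> {s<..t} = {}" for s t
      by (rule Suc.prems(4)) (use that b' M Suc.prems in \<open>auto simp: F'_def\<close>)
    show "f s = g t" if "a \<le> s" "s < t" "t \<in> F'" "F' \<inter> {s<..<t} = {}" for s t
    proof (rule Suc.prems(5))
      have "t \<le> M" using that(3) M(2) by (simp add: F'_def)
      then show "F \<inter> {s<..<t} = {}" using that(4) by (auto simp: F'_def)
    qed (use that in \<open>auto simp: F'_def\<close>)
  qed (use b' in auto)
  moreover have "f b' = g M"
    by (rule Suc.prems(5)) (use b' M in \<open>auto simp: F'_def\<close>)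
  moreover have "f M = f b"
    by (rule Suc.prems(4)) (use M Suc.prems(3) in fastforce)+
  moreover have "(\<Sum>t\<in>F. f t - g t) = f M - g M + (\<Sum>t\<in>F'. f t - g t)"
    unfolding F'_def using M Suc.prems(1) by (intro sum.remove) auto
  ultimately show ?case by linarith
qed

lemma last_update_cases:
  assumes "finite (V \<inter> {..t})" "V \<subseteq> {0<..}" "0 < t"
  shows "0 \<le> last_update V t" "last_update V t < t" "V \<inter> {last_update V t<..<t} = {}"
    "last_update V t = 0 \<or> last_update V t \<in> V"
proof -
  have fin: "finite (V \<inter> {..<t})" by (rule finite_subset[OF _ assms(1)]) auto
  have "0 \<le> last_update V t \<and> last_update V t < t \<and> V \<inter> {last_update V t<..<t} = {} \<and>
      (last_update V t = 0 \<or> last_update V t \<in> V)"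
  proof (cases "V \<inter> {..<t} = {}")
    case True
    then show ?thesis using assms by (auto simp: last_update_def)
  next
    case False
    then have "Max (V \<inter> {..<t}) \<in> V \<inter> {..<t}" using fin by (rule Max_in[rotated])
    moreover have "s \<le> Max (V \<inter> {..<t})" if "s \<in> V" "s < t" for s
      using fin that by (intro Max_ge) auto
    moreover have "last_update V t = Max (V \<inter> {..<t})"
      using False by (simp add: last_update_def)
    ultimately have "last_update V t \<in> V" "last_update V t < t"
      and "\<And>s. s \<in> V \<Longrightarrow> s < t \<Longrightarrow> s \<le> last_update V t" by auto
    then show ?thesis using assms(2) by (auto simp: not_less[symmetric])
  qed
  then show "0 \<le> last_update V t" "last_update V t < t" "V \<inter> {last_update V t<..<t} = {}"
    "last_update V t = 0 \<or> last_update V t \<in> V" by auto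
qed

lemma last_update_ge:
  assumes "finite (V \<inter> {..t})" "s \<in> V" "s < t"
  shows "s \<le> last_update V t"
proof -
  have "finite (V \<inter> {..<t})" by (rule finite_subset[OF _ assms(1)]) auto
  then show ?thesis using assms by (auto simp: last_update_def intro!: Max_ge)
qed

text \<open>The time \<open>f x\<close> of the latest update up to and including \<open>x\<close>
  jumps at each update by exactly the gap, so the gaps telescope to \<open>f b - f a\<close>, where
  \<open>f x\<close> lies between \<open>x - 1\<close> and \<open>x\<close>. The slack of 1 accounts
  for the intervals that straddle an endpoint.\<close>

lemma sum_update_gaps:
  assumes fin: "\<And>T. finite (V \<inter> {..T})" and pos: "V \<subseteq> {0<..}"
    and daily: "\<And>t. 0 \<le> t \<Longrightarrow> V \<inter> {t<..t + 1} \<noteq> {}" and ab: "0 \<le> a" "a \<le> b"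
  shows "(\<Sum>t\<in>V \<inter> {a<..b}. t - last_update V t) \<le> b - a + 1"
    and "b - a - 1 \<le> (\<Sum>t\<in>V \<inter> {a<..b}. t - last_update V t)"
proof -
  define f where "f x = (if V \<inter> {..x} = {} then 0 else Max (V \<inter> {..x}))" for x :: real
  have f_in: "f x = 0 \<or> f x \<in> V \<inter> {..x}" for x
    using Max_in[OF fin[of x]] by (auto simp: f_def)
  have f_ge: "s \<le> f x" if "s \<in> V" "s \<le> x" for s x
    using that Max_ge[OF fin[of x], of s] by (auto simp: f_def)
  have f0: "0 \<le> f x" for x using f_in[of x] pos by auto
  have fle: "f x \<le> x" if "0 \<le> x" for x using f_in[of x] that by auto
  have fge: "x - 1 \<le> f x" if "0 \<le> x" for x
  proof (cases "x \<le> 1")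
    case True
    then show ?thesis using f0[of x] by linarith
  next
    case False
    then obtain s where "s \<in> V" "x - 1 < s" "s \<le> x" using daily[of "x - 1"] by auto
    then show ?thesis using f_ge[of s x] by linarith
  qed
  have "f b - f a = (\<Sum>t\<in>V \<inter> {a<..b}. f t - last_update V t)"
  proof (rule sum_jumps)
    show "finite (V \<inter> {a<..b})" by (rule finite_subset[OF _ fin[of b]]) auto
    show "f s = f t" if "a \<le> s" "s \<le> t" "t \<le> b" "V \<inter> {a<..b} \<inter> {s<..t} = {}" for s t
    proof -
      have "V \<inter> {..s} = V \<inter> {..t}"
      proof
        show "V \<inter> {..s} \<subseteq> V \<inter> {..t}" using that(2) by auto
        show "V \<inter> {..t} \<subseteq> V \<inter> {..s}"
        proof
          fix v assume v: "v \<in> V \<inter> {..t}"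
          have "v \<in> V \<inter> {a<..b} \<inter> {s<..t}" if "s < v" using v that \<open>a \<le> s\<close> \<open>t \<le> b\<close> by auto
          then show "v \<in> V \<inter> {..s}" using that(4) v by force
        qed
      qed
      then show ?thesis by (simp add: f_def)
    qed
    show "f s = last_update V t"
      if "a \<le> s" "s < t" "t \<in> V \<inter> {a<..b}" "V \<inter> {a<..b} \<inter> {s<..<t} = {}" for s t
    proof -
      have "V \<inter> {..s} = V \<inter> {..<t}"
      proof
        show "V \<inter> {..s} \<subseteq> V \<inter> {..<t}" using that(2) by auto
        show "V \<inter> {..<t} \<subseteq> V \<inter> {..s}"
        proof
          fix v assume v: "v \<in> V \<inter> {..<t}"
          have "v \<in> V \<inter> {a<..b} \<inter> {s<..<t}" if "s < v"
            using v that \<open>a \<le> s\<close> \<open>t \<in> V \<inter> {a<..b}\<close> by auto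
          then show "v \<in> V \<inter> {..s}" using that(4) v by force
        qed
      qed
      then show ?thesis by (simp add: f_def last_update_def)
    qed
  qed (use ab in auto)
  also have "\<dots> = (\<Sum>t\<in>V \<inter> {a<..b}. t - last_update V t)"
  proof (rule sum.cong)
    fix t assume "t \<in> V \<inter> {a<..b}"
    then have "f t = t" using f_ge[of t t] fle[of t] ab by force
    then show "f t - last_update V t = t - last_update V t" by simp
  qed simp
  finally have eq: "f b - f a = (\<Sum>t\<in>V \<inter> {a<..b}. t - last_update V t)" .
  show "(\<Sum>t\<in>V \<inter> {a<..b}. t - last_update V t) \<le> b - a + 1"
    using eq fle[of b] fge[of a] ab by linarith
  show "b - a - 1 \<le> (\<Sum>t\<in>V \<inter> {a<..b}. t - last_update V t)"
    using eq fle[of a] fge[of b] ab by linarith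
qed

subsection \<open>The potential of a market\<close>

locale ces_market =
  fixes B :: "'b set" and e :: "'b \<Rightarrow> real" and w :: "'b \<Rightarrow> 'n::finite \<Rightarrow> real" and c :: "'b \<Rightarrow> real"
  assumes finite_B: "finite B"
    and e_pos: "i \<in> B \<Longrightarrow> 0 < e i"
    and w_nonneg: "i \<in> B \<Longrightarrow> 0 \<le> w i k"
    and w_pos: "i \<in> B \<Longrightarrow> \<exists>k. 0 < w i k"
    and c_pos: "i \<in> B \<Longrightarrow> 0 < c i"
    and c_le: "i \<in> B \<Longrightarrow> c i \<le> 1"
begin

definition pos :: "real ^ 'n \<Rightarrow> bool" where "pos p \<longleftrightarrow> (\<forall>k. 0 < p $ k)"

abbreviation index where "index i \<equiv> price_index (w i) (c i)"

abbreviation share where "share i \<equiv> budget_share (w i) (c i)"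

definition total_demand :: "real ^ 'n \<Rightarrow> 'n \<Rightarrow> real" where
  "total_demand p j = (\<Sum>i\<in>B. demand (w i) (c i) (e i) p j)"

text \<open>\<open>index i p powr (1 / c i)\<close> is the least cost of one unit of utility for
  buyer \<open>i\<close>. Up to an additive constant this is therefore the dual objective of the
  Eisenberg-Gale program, which maximizes the money-weighted sum of log utilities.\<close>

definition potential :: "real ^ 'n \<Rightarrow> real" where
  "potential p = (\<Sum>j\<in>UNIV. p $ j) - (\<Sum>i\<in>B. e i / c i * ln (index i p))"

text \<open>Bounds the sensitivity of demand for \<open>j\<close>, weighted by its price, to the
  logarithm of another price \<open>k\<close>: the derivative is minus this sum with each summand
  scaled by \<open>c i\<close>. Its symmetry and row sums drive the later charging argument.\<close>

definition joint_share :: "real ^ 'n \<Rightarrow> 'n \<Rightarrow> 'n \<Rightarrow> real" where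
  "joint_share p j k = (\<Sum>i\<in>B. e i * share i p j * share i p k)"

lemma index_pos: "pos p \<Longrightarrow> i \<in> B \<Longrightarrow> 0 < index i p"
  using w_pos[of i] price_index_pos[of "w i" _ p "c i"] w_nonneg[of i] unfolding pos_def by blast

lemma share_nonneg: "i \<in> B \<Longrightarrow> 0 \<le> share i p k"
  unfolding budget_share_def
  by (intro divide_nonneg_nonneg mult_nonneg_nonneg price_index_nonneg w_nonneg) auto

lemma sum_share: "pos p \<Longrightarrow> i \<in> B \<Longrightarrow> (\<Sum>k\<in>UNIV. share i p k) = 1"
  using index_pos by (intro sum_budget_share) force

lemma joint_share_nonneg: "0 \<le> joint_share p j k"
  unfolding joint_share_def by (intro sum_nonneg mult_nonneg_nonneg share_nonneg less_imp_le[OF e_pos])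

lemma joint_share_commute: "joint_share p j k = joint_share p k j"
  by (simp add: joint_share_def mult_ac)

lemma total_demand_nonneg: "0 \<le> total_demand p j"
  unfolding total_demand_def by (intro sum_nonneg demand_nonneg w_nonneg less_imp_le[OF e_pos])

lemma spending:
  "pos p \<Longrightarrow> p $ j * total_demand p j = (\<Sum>i\<in>B. e i * share i p j)"
  unfolding total_demand_def sum_distrib_left
  by (rule sum.cong) (auto simp: pos_def less_imp_le intro!: price_times_demand)

lemma sum_joint_share:
  assumes "pos p"
  shows "(\<Sum>k\<in>UNIV. joint_share p j k) = p $ j * total_demand p j"
proof -
  have "(\<Sum>k\<in>UNIV. joint_share p j k) = (\<Sum>i\<in>B. e i * share i p j * (\<Sum>k\<in>UNIV. share i p k))"
    unfolding joint_share_def sum_distrib_left by (rule sum.swap)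
  then show ?thesis using assms by (simp add: sum_share spending)
qed

text \<open>
  Jensen's inequality for the logarithm removes the exponents \<open>c i\<close>, so that the estimate
  is the same for CES and Leontief buyers.
\<close>

lemma potential_diff_le:
  assumes p: "pos p" and q: "pos q"
  shows "potential q - potential p \<le>
    (\<Sum>j\<in>UNIV. q $ j - p $ j - p $ j * total_demand p j * ln (q $ j / p $ j))"
proof -
  have i: "e i * (\<Sum>j\<in>UNIV. share i p j * ln (q $ j / p $ j)) \<le>
      e i / c i * ln (index i q) - e i / c i * ln (index i p)" if i: "i \<in> B" for i
  proof -
    let ?r = "\<lambda>j. (q $ j / p $ j) powr c i" and ?y = "index i q / index i p"
    have y: "0 < ?y" using index_pos p q i by simp
    have r: "0 < ?r j" for j using p q by (simp add: pos_def less_imp_neq[symmetric])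
    have yeq: "?y = (\<Sum>j\<in>UNIV. share i p j * ?r j)"
    proof -
      have "share i p j * ?r j = w i j * (q $ j) powr c i / index i p" for j
        using p q by (simp add: pos_def budget_share_def powr_divide less_imp_le less_imp_neq[symmetric])
      then show ?thesis by (simp add: price_index_def[of _ _ q] sum_divide_distrib)
    qed
    have "(\<Sum>j\<in>UNIV. share i p j * (ln (?r j) - ln ?y)) \<le> (\<Sum>j\<in>UNIV. share i p j * (?r j / ?y - 1))"
    proof (intro sum_mono mult_left_mono share_nonneg i)
      fix j
      have "ln u - ln v \<le> u / v - 1" if "0 < u" "0 < v" for u v :: real
        using ln_le_minus_one[of "u / v"] that by (simp add: ln_divide_pos)
      then show "ln (?r j) - ln ?y \<le> ?r j / ?y - 1" using r y by blast
    qed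
    also have "\<dots> = (\<Sum>j\<in>UNIV. share i p j * ?r j) / ?y - (\<Sum>j\<in>UNIV. share i p j)"
    proof -
      have "(\<Sum>j\<in>UNIV. share i p j * (r j / y - 1)) =
          (\<Sum>j\<in>UNIV. share i p j * r j) / y - (\<Sum>j\<in>UNIV. share i p j)" for r y
        by (simp add: right_diff_distrib sum_subtractf sum_divide_distrib)
      then show ?thesis .
    qed
    also have "\<dots> = 0" using index_pos[OF p i] index_pos[OF q i] unfolding yeq[symmetric] by (simp add: sum_share p i)
    finally have "(\<Sum>j\<in>UNIV. share i p j * ln (?r j)) \<le> ln ?y"
      by (simp add: right_diff_distrib sum_subtractf sum_distrib_right[symmetric] sum_share p i)
    moreover have "ln (?r j) = c i * ln (q $ j / p $ j)" for j
      using p q by (simp add: pos_def ln_powr less_imp_neq[symmetric])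
    ultimately have "c i * (\<Sum>j\<in>UNIV. share i p j * ln (q $ j / p $ j)) \<le> ln ?y"
      by (simp add: sum_distrib_left mult_ac)
    then have "(e i / c i) * (c i * (\<Sum>j\<in>UNIV. share i p j * ln (q $ j / p $ j))) \<le> (e i / c i) * ln ?y"
      using e_pos[OF i] c_pos[OF i] by (intro mult_left_mono) auto
    moreover have "ln ?y = ln (index i q) - ln (index i p)"
      using index_pos p q i by (simp add: ln_divide_pos)
    ultimately show ?thesis using c_pos[OF i] by (simp add: right_diff_distrib)
  qed
  have "(\<Sum>j\<in>UNIV. p $ j * total_demand p j * ln (q $ j / p $ j)) =
      (\<Sum>i\<in>B. e i * (\<Sum>j\<in>UNIV. share i p j * ln (q $ j / p $ j)))"
    unfolding spending[OF p] sum_distrib_left sum_distrib_right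
    by (subst sum.swap) (simp add: mult_ac)
  also have "\<dots> \<le> (\<Sum>i\<in>B. e i / c i * ln (index i q) - e i / c i * ln (index i p))"
    by (rule sum_mono) (rule i)
  finally show ?thesis
    unfolding potential_def by (simp add: sum_subtractf)
qed

text \<open>The quadratic term comes only from bounding \<open>ln (1 + \<delta>)\<close> below by
  \<open>\<delta> - 2 * \<delta>^2\<close>, which holds for \<bar>\<delta>\<bar> up to 1/2. The
  linear term is minus the excess demand times the price change.\<close>

lemma potential_step:
  assumes p: "pos p" and q: "\<And>j. q $ j = p $ j * (1 + \<delta> j)" and d: "\<And>j. \<bar>\<delta> j\<bar> \<le> 1 / 37"
  shows "potential q - potential p \<le>
    (\<Sum>j\<in>UNIV. p $ j * (2 * total_demand p j * (\<delta> j)\<^sup>2 - (total_demand p j - 1) * \<delta> j))"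
proof -
  have "0 < 1 + \<delta> j" for j using d[of j] by linarith
  then have "pos q" using p by (simp add: q pos_def)
  then have "potential q - potential p \<le>
      (\<Sum>j\<in>UNIV. q $ j - p $ j - p $ j * total_demand p j * ln (q $ j / p $ j))"
    by (rule potential_diff_le[OF p])
  also have "\<dots> \<le> (\<Sum>j\<in>UNIV. p $ j * (2 * total_demand p j * (\<delta> j)\<^sup>2 - (total_demand p j - 1) * \<delta> j))"
  proof (rule sum_mono)
    fix j
    have pj: "0 < p $ j" using p by (simp add: pos_def)
    have "\<bar>ln (1 + \<delta> j) - \<delta> j\<bar> \<le> 2 * (\<delta> j)\<^sup>2"
      using d[of j] by (intro abs_ln_one_plus_x_minus_x_bound) auto
    then have "\<delta> j - 2 * (\<delta> j)\<^sup>2 \<le> ln (1 + \<delta> j)" by linarith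
    then have "p $ j * total_demand p j * (\<delta> j - 2 * (\<delta> j)\<^sup>2) \<le> p $ j * total_demand p j * ln (1 + \<delta> j)"
      using pj total_demand_nonneg by (intro mult_left_mono) auto
    moreover have "q $ j / p $ j = 1 + \<delta> j" using pj by (simp add: q)
    ultimately show "q $ j - p $ j - p $ j * total_demand p j * ln (q $ j / p $ j) \<le>
        p $ j * (2 * total_demand p j * (\<delta> j)\<^sup>2 - (total_demand p j - 1) * \<delta> j)"
      by (simp add: q algebra_simps)
  qed
  finally show ?thesis .
qed

lemma powr_dist_one_le:
  fixes x r :: real
  assumes "0 < x" "0 < r" "r \<le> 1"
  shows "\<bar>x powr r - 1\<bar> \<le> \<bar>x - 1\<bar>"
proof (cases "1 \<le> x")
  case True
  then have "x powr r \<le> x powr 1" "1 \<le> x powr r"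
    using assms powr_mono[of r 1 x] ge_one_powr_ge_zero[of x r] by auto
  then show ?thesis using True by simp
next
  case False
  then have "x powr 1 \<le> x powr r" "x powr r \<le> 1"
    using assms powr_mono'[of r 1 x] powr_le1[of r x] by auto
  then show ?thesis using False assms by simp
qed

text \<open>With price \<open>j\<close> unchanged, a buyer's demand for \<open>j\<close> is merely
  divided by the ratio \<open>\<gamma>\<close> of the indices. This ratio differs from 1 by at most
  the share-weighted mean of the relative changes, hence is at least 36/37, and its reciprocal costs
  the factor 37/36.\<close>

lemma demand_step:
  assumes p: "pos p" and q: "\<And>k. q $ k = p $ k * (1 + \<delta> k)" and d: "\<And>k. \<bar>\<delta> k\<bar> \<le> 1 / 37"
    and j: "\<delta> j = 0"
  shows "p $ j * \<bar>total_demand q j - total_demand p j\<bar> \<le> 37 / 36 * (\<Sum>k\<in>UNIV. joint_share p j k * \<bar>\<delta> k\<bar>)"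
proof -
  have one: "0 < 1 + \<delta> k" for k using d[of k] by linarith
  have i: "p $ j * \<bar>demand (w i) (c i) (e i) q j - demand (w i) (c i) (e i) p j\<bar> \<le>
      37 / 36 * (\<Sum>k\<in>UNIV. e i * share i p j * share i p k * \<bar>\<delta> k\<bar>)" if i: "i \<in> B" for i
  proof -
    define \<gamma> where "\<gamma> = index i q / index i p"
    define D where "D = (\<Sum>k\<in>UNIV. share i p k * \<bar>\<delta> k\<bar>)"
    have "\<gamma> = (\<Sum>k\<in>UNIV. share i p k * (1 + \<delta> k) powr c i)"
      unfolding \<gamma>_def price_index_def[of _ _ q] sum_divide_distrib
      by (rule sum.cong) (use p one in \<open>auto simp: budget_share_def q powr_mult pos_def less_imp_le\<close>)
    then have "\<gamma> - 1 = (\<Sum>k\<in>UNIV. share i p k * ((1 + \<delta> k) powr c i - 1))"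
      using sum_share[OF p i] by (simp add: right_diff_distrib sum_subtractf)
    then have "\<bar>\<gamma> - 1\<bar> \<le> (\<Sum>k\<in>UNIV. \<bar>share i p k * ((1 + \<delta> k) powr c i - 1)\<bar>)" by simp
    also have "\<dots> \<le> D"
      unfolding D_def
    proof (rule sum_mono)
      fix k
      have "\<bar>(1 + \<delta> k) powr c i - 1\<bar> \<le> \<bar>1 + \<delta> k - 1\<bar>"
        using one c_pos c_le i by (intro powr_dist_one_le) auto
      then show "\<bar>share i p k * ((1 + \<delta> k) powr c i - 1)\<bar> \<le> share i p k * \<bar>\<delta> k\<bar>"
        using share_nonneg[OF i, of p k] by (simp add: abs_mult mult_left_mono)
    qed
    finally have gD: "\<bar>\<gamma> - 1\<bar> \<le> D" .
    have "D \<le> (\<Sum>k\<in>UNIV. share i p k * (1 / 37))"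
      unfolding D_def by (intro sum_mono mult_left_mono d share_nonneg i)
    also have "\<dots> = 1 / 37" unfolding sum_distrib_right[symmetric] sum_share[OF p i] by simp
    finally have g: "36 / 37 \<le> \<gamma>" using gD by linarith
    have "demand (w i) (c i) (e i) q j = demand (w i) (c i) (e i) p j / \<gamma>"
      using index_pos[OF p i] g by (simp add: demand_def q j \<gamma>_def)
    then have "demand (w i) (c i) (e i) q j - demand (w i) (c i) (e i) p j =
        demand (w i) (c i) (e i) p j * ((1 - \<gamma>) / \<gamma>)"
      using g by (simp add: field_simps)
    then have "p $ j * \<bar>demand (w i) (c i) (e i) q j - demand (w i) (c i) (e i) p j\<bar> =
        (p $ j * demand (w i) (c i) (e i) p j) * (\<bar>\<gamma> - 1\<bar> / \<gamma>)"
      using demand_nonneg[of "w i" "e i" "c i" p j] w_nonneg[OF i] e_pos[OF i] g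
      by (simp add: abs_mult abs_minus_commute)
    also have "\<dots> = e i * share i p j * (\<bar>\<gamma> - 1\<bar> / \<gamma>)"
      using p by (subst price_times_demand) (auto simp: pos_def less_imp_le)
    also have "\<dots> \<le> e i * share i p j * (37 / 36 * D)"
    proof (intro mult_left_mono mult_nonneg_nonneg share_nonneg i less_imp_le[OF e_pos])
      have "D \<le> 37 / 36 * D * \<gamma>" using mult_left_mono[OF g, of "37 / 36 * D"] gD by simp
      then show "\<bar>\<gamma> - 1\<bar> / \<gamma> \<le> 37 / 36 * D" using g gD by (simp add: divide_le_eq)
    qed
    also have "\<dots> = 37 / 36 * (\<Sum>k\<in>UNIV. e i * share i p j * share i p k * \<bar>\<delta> k\<bar>)"
      by (simp add: D_def sum_distrib_left mult_ac)
    finally show ?thesis .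
  qed
  have "p $ j * \<bar>total_demand q j - total_demand p j\<bar> \<le>
      p $ j * (\<Sum>i\<in>B. \<bar>demand (w i) (c i) (e i) q j - demand (w i) (c i) (e i) p j\<bar>)"
    unfolding total_demand_def sum_subtractf[symmetric]
    using p by (intro mult_left_mono sum_abs) (simp add: pos_def less_imp_le)
  also have "\<dots> \<le> (\<Sum>i\<in>B. 37 / 36 * (\<Sum>k\<in>UNIV. e i * share i p j * share i p k * \<bar>\<delta> k\<bar>))"
    unfolding sum_distrib_left[of "p $ j"] by (rule sum_mono) (rule i)
  also have "\<dots> = 37 / 36 * (\<Sum>k\<in>UNIV. joint_share p j k * \<bar>\<delta> k\<bar>)"
    unfolding joint_share_def sum_distrib_left sum_distrib_right by (rule sum.swap)
  finally show ?thesis .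
qed

section \<open>Market quantities at two price vectors within a factor \<open>R\<close>\<close>

context
  fixes p q :: "real ^ 'n" and R :: real
  assumes p: "pos p" and q: "pos q" and R: "1 \<le> R"
    and pq: "\<And>k. p $ k \<le> R * q $ k" and qp: "\<And>k. q $ k \<le> R * p $ k"
begin

lemma powr_ratio:
  assumes "i \<in> B"
  shows "(p $ k) powr c i \<le> R * (q $ k) powr c i" "(q $ k) powr c i \<le> R * (p $ k) powr c i"
proof -
  have "x powr c i \<le> R * y powr c i" if "0 < x" "0 < y" "x \<le> R * y" for x y
  proof -
    have "x powr c i \<le> (R * y) powr c i"
      using that c_pos[OF assms] by (intro powr_mono2) auto
    also have "\<dots> = R powr c i * y powr c i" using R that by (simp add: powr_mult)
    also have "\<dots> \<le> R * y powr c i"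
      using powr_mono[OF c_le[OF assms] R] R by (intro mult_right_mono) auto
    finally show ?thesis .
  qed
  then show "(p $ k) powr c i \<le> R * (q $ k) powr c i" "(q $ k) powr c i \<le> R * (p $ k) powr c i"
    using p q pq qp by (auto simp: pos_def)
qed

lemma index_ratio:
  assumes "i \<in> B"
  shows "index i q \<le> R * index i p"
  unfolding price_index_def sum_distrib_left
proof (rule sum_mono)
  fix k
  show "w i k * (q $ k) powr c i \<le> R * (w i k * (p $ k) powr c i)"
    using mult_left_mono[OF powr_ratio(2)[OF assms] w_nonneg[OF assms], of k] by (simp add: mult_ac)
qed

text \<open>One factor \<open>R\<close> comes from the numerator and one from the index. A joint
  share multiplies two shares and so picks up \<open>R ^ 4\<close>.\<close>

lemma share_ratio:
  assumes "i \<in> B"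
  shows "share i p k \<le> R\<^sup>2 * share i q k"
proof -
  have "w i k * (p $ k) powr c i \<le> R * (w i k * (q $ k) powr c i)"
    using mult_left_mono[OF powr_ratio(1)[OF assms] w_nonneg[OF assms], of k] by (simp add: mult_ac)
  then have "w i k * (p $ k) powr c i * index i q \<le> (R * (w i k * (q $ k) powr c i)) * (R * index i p)"
    using R w_nonneg[OF assms] index_pos[OF q assms]
    by (intro mult_mono[OF _ index_ratio[OF assms]]) auto
  then show ?thesis
    using index_pos[OF p assms] index_pos[OF q assms]
    by (simp add: budget_share_def field_simps power2_eq_square)
qed

lemma joint_share_ratio: "joint_share p j k \<le> R ^ 4 * joint_share q j k"
  unfolding joint_share_def sum_distrib_left
proof (rule sum_mono)
  fix i assume i: "i \<in> B"
  have "share i p j * share i p k \<le> (R\<^sup>2 * share i q j) * (R\<^sup>2 * share i q k)"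
    by (intro mult_mono share_ratio i mult_nonneg_nonneg share_nonneg) simp
  then have "e i * (share i p j * share i p k) \<le> e i * ((R\<^sup>2 * share i q j) * (R\<^sup>2 * share i q k))"
    using e_pos[OF i] by (intro mult_left_mono) auto
  also have "\<dots> = R ^ 4 * (e i * share i q j * share i q k)"
    by (simp add: power4_eq_xxxx power2_eq_square mult_ac)
  finally show "e i * share i p j * share i p k \<le> R ^ 4 * (e i * share i q j * share i q k)"
    by (simp add: mult_ac)
qed

text \<open>Equality of the \<open>j\<close>-th prices leaves only the indices to vary, so a single
  factor \<open>R\<close> suffices.\<close>

lemma total_demand_ratio:
  assumes "p $ j = q $ j"
  shows "total_demand p j \<le> R * total_demand q j"
  unfolding total_demand_def sum_distrib_left
proof (rule sum_mono)
  fix i assume i: "i \<in> B"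
  let ?a = "e i * w i j * (if c i = 1 then 1 else (q $ j) powr (c i - 1))"
  have "?a * index i q \<le> ?a * (R * index i p)"
    using e_pos[OF i] w_nonneg[OF i] by (intro mult_left_mono index_ratio i) auto
  then have "?a / index i p \<le> R * (?a / index i q)"
    using index_pos[OF p i] index_pos[OF q i]
    by (simp only: pos_divide_le_eq) (simp add: field_simps del: if_split)
  then show "demand (w i) (c i) (e i) p j \<le> R * demand (w i) (c i) (e i) q j"
    by (simp only: demand_def assms)
qed

end

end

subsection \<open>Descent of the potential\<close>

text \<open>The process in terms of the demand function: price positivity is assumed, and the bounds
  by \<open>Min\<close> and \<open>Max\<close> are replaced by moments inside the update interval
  that witness them. \<open>tatonnement_is_ces\<close> derives both from the original model.\<close>

locale ces_tatonnement = ces_market B e w c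
  for B :: "'b set" and e :: "'b \<Rightarrow> real" and w :: "'b \<Rightarrow> 'n::finite \<Rightarrow> real" and c :: "'b \<Rightarrow> real" +
  fixes lam :: real and U :: "'n \<Rightarrow> real set" and zt :: "'n \<Rightarrow> real \<Rightarrow> real" and p :: "real \<Rightarrow> real ^ 'n"
  assumes lam: "0 < lam" "lam \<le> 1 / 37"
    and update_pos: "U j \<subseteq> {0<..}"
    and update_locally_finite: "finite (U j \<inter> {..T})"
    and update_daily: "0 \<le> t \<Longrightarrow> U j \<inter> {t<..t + 1} \<noteq> {}"
    and price_constant: "\<lbrakk>0 \<le> s; s \<le> t; U j \<inter> {s<..t} = {}\<rbrakk> \<Longrightarrow> p t $ j = p s $ j"
    and price_pos: "0 \<le> t \<Longrightarrow> pos (p t)"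
    and zt_lower: "t \<in> U j \<Longrightarrow> \<exists>s. last_update (U j) t < s \<and> s < t \<and> total_demand (p s) j - 1 \<le> zt j t"
    and zt_upper: "t \<in> U j \<Longrightarrow> \<exists>s. last_update (U j) t < s \<and> s < t \<and> zt j t \<le> total_demand (p s) j - 1"
    and update: "t \<in> U j \<Longrightarrow>
      p t $ j = p (last_update (U j) t) $ j *
        (1 + lam * min (zt j t) 1 * (t - last_update (U j) t))"
begin

abbreviation last where "last j t \<equiv> last_update (U j) t"

text \<open>The value 0 away from the updates of \<open>j\<close> makes every derived quantity
  vanish there, so sums over a single good extend to all update times of all goods.\<close>

definition gap where "gap j t = (if t \<in> U j then t - last j t else 0)"

definition clip where "clip j t = min (zt j t) 1"

definition rel where "rel j t = lam * clip j t * gap j t"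

definition pre :: "real \<Rightarrow> real ^ 'n" where "pre t = (\<chi> j. p (last j t) $ j)"

definition times :: "real set" where "times = (\<Union>j. U j)"

lemma last_facts:
  assumes "0 < t"
  shows "0 \<le> last j t" "last j t < t" "U j \<inter> {last j t<..<t} = {}"
  using last_update_cases[OF update_locally_finite update_pos assms] by auto

lemma times_finite: "finite (times \<inter> {..T})"
proof -
  have "finite (\<Union>j. U j \<inter> {..T})"
    by (intro finite_UN_I update_locally_finite) simp
  then show ?thesis by (rule rev_finite_subset) (auto simp: times_def)
qed

lemma times_finite': "F \<subseteq> times \<inter> {..T} \<Longrightarrow> finite F"
  by (rule finite_subset[OF _ times_finite])

lemma times_pos: "t \<in> times \<Longrightarrow> 0 < t"
  using update_pos by (auto simp: times_def)

lemma gap_le: "gap j t \<le> 1"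
proof (cases "t \<in> U j")
  case True
  then have t: "0 < t" using update_pos by auto
  obtain s where s: "s \<in> U j" "last j t < s" "s \<le> last j t + 1"
    using update_daily[OF last_facts(1)[OF t], of j j] by auto
  then have "t \<le> s" using last_facts(3)[OF t, of j] by (auto simp: not_less[symmetric])
  then show ?thesis using s by (simp add: gap_def)
qed (simp add: gap_def)

lemma gap_nonneg: "0 \<le> gap j t"
  using last_facts(2)[of t j] update_pos[of j] by (force simp: gap_def)

lemma sum_gaps:
  assumes "0 \<le> a" "a \<le> b"
  shows "(\<Sum>t\<in>U j \<inter> {a<..b}. gap j t) \<le> b - a + 1" "b - a - 1 \<le> (\<Sum>t\<in>U j \<inter> {a<..b}. gap j t)"
proof -
  have "(\<Sum>t\<in>U j \<inter> {a<..b}. gap j t) = (\<Sum>t\<in>U j \<inter> {a<..b}. t - last j t)"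
    by (rule sum.cong) (auto simp: gap_def)
  then show "(\<Sum>t\<in>U j \<inter> {a<..b}. gap j t) \<le> b - a + 1" "b - a - 1 \<le> (\<Sum>t\<in>U j \<inter> {a<..b}. gap j t)"
    using sum_update_gaps[OF update_locally_finite update_pos update_daily assms] by auto
qed

lemma zt_ge: "t \<in> U j \<Longrightarrow> -1 \<le> zt j t"
  using zt_lower[of t j] total_demand_nonneg by (smt (verit))

lemma clip_bounds: "t \<in> U j \<Longrightarrow> \<bar>clip j t\<bar> \<le> 1"
  using zt_ge[of t j] by (auto simp: clip_def)

lemma abs_rel_le: "\<bar>rel j t\<bar> \<le> lam * gap j t"
proof (cases "t \<in> U j")
  case True
  then show ?thesis
    using lam gap_nonneg[of j t] clip_bounds[OF True]
    by (simp add: rel_def abs_mult mult_left_le_one_le mult.assoc mult_left_le)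
qed (simp add: rel_def gap_def)

lemma abs_rel_le': "\<bar>rel j t\<bar> \<le> gap j t / 37"
  using abs_rel_le[of j t] mult_right_mono[OF lam(2) gap_nonneg[of j t]] by simp

lemma abs_rel_small: "\<bar>rel j t\<bar> \<le> 1 / 37"
  using abs_rel_le'[of j t] gap_le[of j t] by simp

lemma rel_eq_0: "t \<notin> U j \<Longrightarrow> rel j t = 0"
  by (simp add: rel_def gap_def)

lemma price_step:
  assumes "0 < t"
  shows "p t $ j = pre t $ j * (1 + rel j t)"
proof (cases "t \<in> U j")
  case True
  then show ?thesis by (simp add: pre_def rel_def gap_def clip_def update)
next
  case False
  have "U j \<inter> {last j t<..t} = {}" using last_facts(3)[OF assms, of j] False by (auto simp: less_le)
  then have "p t $ j = p (last j t) $ j"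
    using last_facts(1,2)[OF assms, of j] by (intro price_constant) auto
  then show ?thesis using False by (simp add: pre_def rel_eq_0)
qed

lemma pre_pos: "0 < t \<Longrightarrow> pos (pre t)"
  using price_pos last_facts(1) by (simp add: pos_def pre_def)

lemma price_eq:
  assumes "0 \<le> s" "s \<le> t" "times \<inter> {s<..t} = {}"
  shows "p s = p t"
proof -
  have "p t $ j = p s $ j" for j
    using assms by (intro price_constant) (auto simp: times_def)
  then show ?thesis by (simp add: vec_eq_iff)
qed

lemma price_eq_last:
  assumes "0 < t" "last j t \<le> s" "s < t"
  shows "p s $ j = pre t $ j"
proof -
  have "{last j t<..s} \<subseteq> {last j t<..<t}" using assms(3) by auto
  then have "U j \<inter> {last j t<..s} = {}" using last_facts(3)[OF assms(1), of j] by blast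
  then show ?thesis
    using last_facts(1)[OF assms(1), of j] assms(2) price_constant[of "last j t" s j]
    by (simp add: pre_def)
qed

lemma price_eq_pre:
  assumes "0 \<le> s" "s < t" "times \<inter> {s<..<t} = {}"
  shows "p s = pre t"
proof -
  have "last j t \<le> s" for j
  proof (rule ccontr)
    assume "\<not> last j t \<le> s"
    moreover have "0 < t" using assms by linarith
    moreover have "last j t = 0 \<or> last j t \<in> U j"
      using calculation(2) by (rule last_update_cases(4)[OF update_locally_finite update_pos])
    ultimately have "last j t \<in> times \<inter> {s<..<t}"
      using assms(1) last_facts(2)[of t j] by (auto simp: times_def)
    then show False using assms(3) by blast
  qed
  then show ?thesis using price_eq_last assms by (simp add: vec_eq_iff)
qed

text \<open>Local finiteness leaves a free interval just before \<open>t\<close>, on which the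
  prices equal \<open>pre t\<close>. Facts about \<open>p\<close> at actual times thereby transfer
  to \<open>pre\<close>.\<close>

lemma pre_attained:
  assumes "a < t"
  obtains b where "a < b" "b < t" "times \<inter> {b..<t} = {}" "0 \<le> a \<Longrightarrow> p b = pre t"
proof -
  let ?F = "insert a (times \<inter> {a<..<t})"
  have F: "finite ?F" using times_finite'[of "times \<inter> {a<..<t}" t] by force
  have "Max ?F \<in> ?F" using F by (intro Max_in) auto
  then have M: "a \<le> Max ?F" "Max ?F < t" using assms by auto
  define b where "b = (Max ?F + t) / 2"
  have b: "a < b" "b < t" "Max ?F < b" using M by (auto simp: b_def)
  have "s \<le> Max ?F" if "s \<in> times" "a < s" "s < t" for s using F that by (intro Max_ge) auto
  then have e: "times \<inter> {b..<t} = {}" using b by force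
  moreover have "p b = pre t" if "0 \<le> a" using b e that by (intro price_eq_pre) auto
  ultimately show ?thesis using that b by blast
qed

lemma sum_price_jumps:
  fixes f :: "real ^ 'n \<Rightarrow> real"
  assumes "0 \<le> a" "a \<le> b"
  shows "f (p b) - f (p a) = (\<Sum>t\<in>times \<inter> {a<..b}. f (p t) - f (pre t))"
proof (rule sum_jumps)
  show "finite (times \<inter> {a<..b})" by (rule times_finite'[of _ b]) auto
  show "f (p s) = f (p t)" if "a \<le> s" "s \<le> t" "t \<le> b" "times \<inter> {a<..b} \<inter> {s<..t} = {}" for s t
  proof (intro arg_cong[where f = f] price_eq)
    show "times \<inter> {s<..t} = {}" using that by fastforce
  qed (use that assms in auto)
  show "f (p s) = f (pre t)"
    if "a \<le> s" "s < t" "t \<in> times \<inter> {a<..b}" "times \<inter> {a<..b} \<inter> {s<..<t} = {}" for s t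
  proof (intro arg_cong[where f = f] price_eq_pre)
    show "times \<inter> {s<..<t} = {}" using that by fastforce
  qed (use that assms in auto)
qed (use assms in auto)

lemma sum_price_jumps_pre:
  fixes f :: "real ^ 'n \<Rightarrow> real"
  assumes "0 \<le> a" "a < b"
  shows "f (pre b) - f (p a) = (\<Sum>t\<in>times \<inter> {a<..<b}. f (p t) - f (pre t))"
proof -
  obtain b' where b': "a < b'" "b' < b" "times \<inter> {b'..<b} = {}" "p b' = pre b"
    using pre_attained[OF assms(2)] assms(1) by metis
  have "times \<inter> {a<..b'} = times \<inter> {a<..<b}" using b' by (force simp: not_less[symmetric])
  then show ?thesis using sum_price_jumps[of a b' f] b' assms by simp
qed

lemma sum_times_eq_sum_updates:
  assumes "\<And>t. t \<notin> U j \<Longrightarrow> 0 < t \<Longrightarrow> f t = 0" "0 \<le> a"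
  shows "(\<Sum>t\<in>times \<inter> {a<..b}. f t) = (\<Sum>t\<in>U j \<inter> {a<..b}. f t)"
proof (rule sum.mono_neutral_right)
  show "finite (times \<inter> {a<..b})" by (rule times_finite'[of _ b]) auto
  show "U j \<inter> {a<..b} \<subseteq> times \<inter> {a<..b}" by (auto simp: times_def)
  show "\<forall>t\<in>times \<inter> {a<..b} - U j \<inter> {a<..b}. f t = 0"
  proof
    fix t assume "t \<in> times \<inter> {a<..b} - U j \<inter> {a<..b}"
    then have "t \<notin> U j" "0 < t" using assms(2) by auto
    then show "f t = 0" by (rule assms(1))
  qed
qed

text \<open>A relative change of size at most \<open>gap / 37\<close> moves the logarithm by at most
  37/36 of that, downward moves being the worse case. The gaps in the window sum to at most
  \<open>b - a + 1\<close>, since the first one may begin before \<open>a\<close>.\<close>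

lemma log_price_change:
  assumes "0 \<le> a" "a \<le> b"
  shows "\<bar>ln (p b $ k) - ln (p a $ k)\<bar> \<le> (b - a + 1) / 36"
proof -
  have jump: "ln (p t $ k) - ln (pre t $ k) = ln (1 + rel k t)" if "0 < t" for t
  proof -
    have "0 < pre t $ k" "0 < 1 + rel k t"
      using pre_pos[OF that] abs_rel_small[of k t] by (auto simp: pos_def abs_le_iff)
    then show ?thesis using price_step[OF that, of k] by (simp add: ln_mult_pos)
  qed
  have "\<bar>ln (p b $ k) - ln (p a $ k)\<bar> = \<bar>\<Sum>t\<in>times \<inter> {a<..b}. ln (p t $ k) - ln (pre t $ k)\<bar>"
    using sum_price_jumps[OF assms, of "\<lambda>x. ln (x $ k)"] by simp
  also have "(\<Sum>t\<in>times \<inter> {a<..b}. ln (p t $ k) - ln (pre t $ k)) =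
      (\<Sum>t\<in>U k \<inter> {a<..b}. ln (p t $ k) - ln (pre t $ k))"
    by (rule sum_times_eq_sum_updates) (use assms in \<open>auto simp: price_step rel_eq_0\<close>)
  also have "\<bar>\<dots>\<bar> \<le> (\<Sum>t\<in>U k \<inter> {a<..b}. gap k t / 36)"
  proof (rule order_trans[OF sum_abs sum_mono])
    fix t assume "t \<in> U k \<inter> {a<..b}"
    then have t: "0 < t" using assms by auto
    define x where "x = rel k t"
    have x: "\<bar>x\<bar> \<le> gap k t / 37" "\<bar>x\<bar> \<le> 1 / 37"
      using abs_rel_le' abs_rel_small by (auto simp: x_def)
    have "ln (1 + x) \<le> x" using x by (intro ln_add_one_self_le_self2) auto
    moreover have "- ln (1 + x) \<le> 37 / 36 * \<bar>x\<bar>"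
    proof -
      have "- ln (1 + x) = ln (1 / (1 + x))" using x by (simp add: ln_div)
      also have "\<dots> \<le> 1 / (1 + x) - 1" using x by (intro ln_le_minus_one) auto
      also have "\<dots> = - x / (1 + x)" using x by (simp add: field_simps)
      also have "\<dots> \<le> \<bar>x\<bar> / (36 / 37)" using x by (intro frac_le) auto
      finally show ?thesis by simp
    qed
    ultimately show "\<bar>ln (p t $ k) - ln (pre t $ k)\<bar> \<le> gap k t / 36"
      unfolding jump[OF t] x_def[symmetric] using x by linarith
  qed
  also have "\<dots> \<le> (b - a + 1) / 36"
    unfolding sum_divide_distrib[symmetric] using sum_gaps(1)[OF assms] by (intro divide_right_mono) auto
  finally show ?thesis .
qed

text \<open>The largest factor by which a price can move within a day:
  \<open>log_price_change\<close> gives 2/36 for a window of length one. The numerical bounds below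
  are \<open>1 / (1 - x)\<close> at 1/18 and 2/9.\<close>

definition R :: real where "R = exp (1 / 18)"

lemma R_bounds: "1 \<le> R" "R \<le> 18 / 17" "R ^ 4 \<le> 9 / 7"
proof -
  have ex: "exp x \<le> 1 / (1 - x)" if "x < 1" for x :: real
    using exp_ge_add_one_self[of "- x"] that by (simp add: exp_minus field_simps)
  show "1 \<le> R" by (simp add: R_def)
  show "R \<le> 18 / 17" using ex[of "1 / 18"] by (simp add: R_def)
  have "R ^ 4 = exp (2 / 9)" by (simp add: R_def exp_of_nat_mult[symmetric])
  then show "R ^ 4 \<le> 9 / 7" using ex[of "2 / 9"] by simp
qed

lemma price_ratio:
  assumes "0 \<le> a" "a \<le> b" "b \<le> a + 1"
  shows "p a $ k \<le> R * p b $ k" "p b $ k \<le> R * p a $ k"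
proof -
  have pos': "0 < p a $ k" "0 < p b $ k" using price_pos[of a] price_pos[of b] assms by (auto simp: pos_def)
  have "\<bar>ln (p b $ k) - ln (p a $ k)\<bar> \<le> 1 / 18"
    by (rule order_trans[OF log_price_change[OF assms(1,2)]]) (use assms(3) in simp)
  then have l: "ln (p b $ k) - ln (p a $ k) \<le> 1 / 18" "ln (p a $ k) - ln (p b $ k) \<le> 1 / 18"
    by linarith+
  have imp: "x \<le> R * y" if "0 < x" "0 < y" "ln x - ln y \<le> 1 / 18" for x y
  proof -
    have "x = exp (ln x)" using that by simp
    also have "\<dots> \<le> exp (1 / 18 + ln y)" using that by (subst exp_le_cancel_iff) linarith
    also have "\<dots> = R * y" using that by (simp add: exp_add R_def)
    finally show ?thesis .
  qed
  show "p a $ k \<le> R * p b $ k" by (rule imp[OF pos' l(2)])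
  show "p b $ k \<le> R * p a $ k" by (rule imp[OF pos'(2,1) l(1)])
qed

lemma pre_ratio:
  assumes "0 \<le> a" "a < t" "t \<le> a + 1"
  shows "p a $ k \<le> R * pre t $ k" "pre t $ k \<le> R * p a $ k"
proof -
  obtain b where "a < b" "b < t" "p b = pre t" using pre_attained[OF assms(2)] assms(1) by metis
  then show "p a $ k \<le> R * pre t $ k" "pre t $ k \<le> R * p a $ k"
    using price_ratio[of a b k] assms by auto
qed

section \<open>Staleness of the excess demand estimates\<close>

lemma last_plus_one: "t \<in> U j \<Longrightarrow> t \<le> last j t + 1"
  using gap_le[of j t] by (simp add: gap_def)

lemma joint_share_pre_le:
  assumes "t \<in> U j" "last j t < \<tau>" "\<tau> < t"
  shows "joint_share (pre \<tau>) j k \<le> 9 / 7 * joint_share (pre t) j k"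
proof -
  have t: "0 < t" using assms update_pos by auto
  have l: "0 \<le> last j t" by (rule last_facts(1)[OF t])
  obtain b where b: "last j t < b" "b < \<tau>" "p b = pre \<tau>" using pre_attained[OF assms(2)] l by metis
  have "joint_share (pre \<tau>) j k \<le> R ^ 4 * joint_share (pre t) j k"
    using pre_ratio[of b t] b l assms last_plus_one[OF assms(1)] pre_pos R_bounds(1)
    by (intro joint_share_ratio) auto
  also have "\<dots> \<le> 9 / 7 * joint_share (pre t) j k"
    by (intro mult_right_mono R_bounds joint_share_nonneg)
  finally show ?thesis .
qed

text \<open>Every jump inside the update interval of \<open>j\<close> leaves price \<open>j\<close>
  alone, so \<open>demand_step\<close> applies to each and the common weight
  \<open>pre t $ j\<close> can be moved through the sum.\<close>

lemma demand_drift: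
  assumes "t \<in> U j" "last j t < s" "s < t"
  shows "pre t $ j * \<bar>total_demand (pre t) j - total_demand (p s) j\<bar> \<le>
    37 / 36 * (\<Sum>\<tau>\<in>times \<inter> {last j t<..<t}. \<Sum>k\<in>UNIV. joint_share (pre \<tau>) j k * \<bar>rel k \<tau>\<bar>)"
proof -
  have t: "0 < t" using assms update_pos by auto
  have s: "0 \<le> s" using last_facts(1)[OF t, of j] assms by linarith
  have fin: "finite (times \<inter> {last j t<..<t})" by (rule times_finite'[of _ t]) auto
  have pj: "0 \<le> pre t $ j" using pre_pos[OF t] by (simp add: pos_def less_imp_le)
  have "pre t $ j * \<bar>total_demand (pre t) j - total_demand (p s) j\<bar> \<le>
      pre t $ j * (\<Sum>\<tau>\<in>times \<inter> {s<..<t}. \<bar>total_demand (p \<tau>) j - total_demand (pre \<tau>) j\<bar>)"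
    unfolding sum_price_jumps_pre[OF s assms(3), of "\<lambda>x. total_demand x j"]
    by (intro mult_left_mono sum_abs pj)
  also have "\<dots> \<le> pre t $ j * (\<Sum>\<tau>\<in>times \<inter> {last j t<..<t}. \<bar>total_demand (p \<tau>) j - total_demand (pre \<tau>) j\<bar>)"
    by (intro mult_left_mono sum_mono2 fin pj) (use assms in auto)
  also have "\<dots> \<le> (\<Sum>\<tau>\<in>times \<inter> {last j t<..<t}. 37 / 36 * (\<Sum>k\<in>UNIV. joint_share (pre \<tau>) j k * \<bar>rel k \<tau>\<bar>))"
    unfolding sum_distrib_left[of "pre t $ j"]
  proof (rule sum_mono)
    fix \<tau> assume "\<tau> \<in> times \<inter> {last j t<..<t}"
    then have \<tau>: "0 < \<tau>" "last j t < \<tau>" "\<tau> < t" using times_pos by auto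
    have nU: "\<tau> \<notin> U j" using last_facts(3)[OF t, of j] \<tau> by auto
    have "pre \<tau> $ j = pre t $ j"
      using price_eq_last[OF t, of j \<tau>] price_step[OF \<tau>(1), of j] \<tau> nU by (simp add: rel_eq_0)
    moreover have "pre \<tau> $ j * \<bar>total_demand (p \<tau>) j - total_demand (pre \<tau>) j\<bar> \<le>
        37 / 36 * (\<Sum>k\<in>UNIV. joint_share (pre \<tau>) j k * \<bar>rel k \<tau>\<bar>)"
      by (rule demand_step[OF pre_pos[OF \<tau>(1)] price_step[OF \<tau>(1)] abs_rel_small rel_eq_0[OF nU]])
    ultimately show "pre t $ j * \<bar>total_demand (p \<tau>) j - total_demand (pre \<tau>) j\<bar> \<le>
        37 / 36 * (\<Sum>k\<in>UNIV. joint_share (pre \<tau>) j k * \<bar>rel k \<tau>\<bar>)" by simp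
  qed
  finally show ?thesis by (simp add: sum_distrib_left)
qed

text \<open>The estimate lies between the excess demands at two moments of the interval, so its
  error is at most the larger of two drifts.\<close>

lemma zt_error:
  assumes "t \<in> U j"
  shows "pre t $ j * \<bar>zt j t - (total_demand (pre t) j - 1)\<bar> \<le>
    37 / 36 * (\<Sum>\<tau>\<in>times \<inter> {last j t<..<t}. \<Sum>k\<in>UNIV. joint_share (pre \<tau>) j k * \<bar>rel k \<tau>\<bar>)"
proof -
  have t: "0 < t" using assms update_pos by auto
  have pj: "0 \<le> pre t $ j" using pre_pos[OF t] by (simp add: pos_def less_imp_le)
  obtain s1 where s1: "last j t < s1" "s1 < t" "total_demand (p s1) j - 1 \<le> zt j t"
    using zt_lower[OF assms] by blast
  obtain s2 where s2: "last j t < s2" "s2 < t" "zt j t \<le> total_demand (p s2) j - 1"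
    using zt_upper[OF assms] by blast
  have "\<bar>zt j t - (total_demand (pre t) j - 1)\<bar> \<le> \<bar>total_demand (pre t) j - total_demand (p s1) j\<bar>
    \<or> \<bar>zt j t - (total_demand (pre t) j - 1)\<bar> \<le> \<bar>total_demand (pre t) j - total_demand (p s2) j\<bar>"
    using s1(3) s2(3) by linarith
  then show ?thesis
    using demand_drift[OF assms s1(1,2)] demand_drift[OF assms s2(1,2)]
      mult_left_mono[OF _ pj] order_trans by meson
qed

text \<open>The first-order decrease of the potential if the estimate were exact: the price change
  times \<open>zt\<close>. It is nonnegative because truncation preserves the sign.\<close>

definition gain where "gain j t = pre t $ j * lam * clip j t * zt j t * gap j t"

text \<open>An upper bound for price times demand times the squared relative change. One of the two
  factors \<open>gap\<close> is dropped so that it scales with the gap as \<open>gain\<close> and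
  the cross charges do.\<close>

definition cost where
  "cost j t = lam\<^sup>2 * gap j t * (clip j t)\<^sup>2 * (pre t $ j * total_demand (pre t) j)"

lemma gain_nonneg:
  assumes "0 < t"
  shows "0 \<le> gain j t"
proof -
  have "0 \<le> clip j t * zt j t" by (auto simp: clip_def min_def zero_le_mult_iff)
  moreover have "0 \<le> pre t $ j * lam" using pre_pos[OF assms] lam by (simp add: pos_def less_imp_le)
  ultimately have "0 \<le> pre t $ j * lam * (clip j t * zt j t) * gap j t"
    using gap_nonneg mult_nonneg_nonneg by blast
  then show ?thesis by (simp add: gain_def mult_ac)
qed

text \<open>Current demand is at most 18/17 of \<open>1 + zt j t\<close>, as only the indices have
  moved since the witness time. Truncation then gives
  \<open>(1 + zt) * clip^2 \<le> 2 * clip * zt\<close>: below 1 because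
  \<open>1 + zt \<le> 2\<close>, above 1 because \<open>clip = 1\<close>. The remaining factor
  \<open>36 / 17 * lam\<close> is below 1/8.\<close>

lemma cost_le_gain:
  assumes "0 < t"
  shows "8 * cost j t \<le> gain j t"
proof (cases "t \<in> U j")
  case True
  have pj: "0 < pre t $ j" using pre_pos[OF assms] by (simp add: pos_def)
  obtain s where s: "last j t < s" "s < t" "total_demand (p s) j - 1 \<le> zt j t"
    using zt_lower[OF True] by blast
  have s0: "0 \<le> s" using last_facts(1)[OF assms, of j] s by linarith
  have "total_demand (pre t) j \<le> R * total_demand (p s) j"
    using pre_ratio[of s t] s0 s last_plus_one[OF True] R_bounds price_eq_last[OF assms, of j s]
    by (intro total_demand_ratio pre_pos price_pos assms) auto
  also have "\<dots> \<le> 18 / 17 * (1 + zt j t)"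
    using s(3) total_demand_nonneg[of "p s" j] R_bounds by (intro mult_mono) auto
  finally have X: "total_demand (pre t) j \<le> 18 / 17 * (1 + zt j t)" .
  have "(1 + zt j t) * (clip j t)\<^sup>2 \<le> 2 * (clip j t * zt j t)"
  proof (cases "zt j t \<le> 1")
    case z: True
    then have "(1 + zt j t) * (zt j t)\<^sup>2 \<le> 2 * (zt j t)\<^sup>2"
      by (intro mult_right_mono) auto
    then show ?thesis using z by (simp add: clip_def power2_eq_square)
  qed (simp add: clip_def)
  moreover have "total_demand (pre t) j * (clip j t)\<^sup>2 \<le> 18 / 17 * ((1 + zt j t) * (clip j t)\<^sup>2)"
    using mult_right_mono[OF X, of "(clip j t)\<^sup>2"] by (simp only: mult.assoc zero_le_power2)
  ultimately have "total_demand (pre t) j * (clip j t)\<^sup>2 \<le> 36 / 17 * (clip j t * zt j t)"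
    by linarith
  then have "(pre t $ j * gap j t * lam * lam) * (total_demand (pre t) j * (clip j t)\<^sup>2) \<le>
      (pre t $ j * gap j t * lam * lam) * (36 / 17 * (clip j t * zt j t))"
    using pj gap_nonneg lam by (intro mult_left_mono) auto
  then have "cost j t \<le> 36 / 17 * lam * gain j t"
    by (simp add: cost_def gain_def power2_eq_square mult_ac)
  also have "\<dots> \<le> 36 / 17 * (1 / 37) * gain j t"
    using lam gain_nonneg[OF assms] by (intro mult_right_mono mult_left_mono) auto
  finally show ?thesis using gain_nonneg[OF assms, of j] by simp
qed (simp add: cost_def gain_def gap_def)

section \<open>Amortized balance of gains and charges\<close>

definition total_gain :: "real \<Rightarrow> real" where
  "total_gain T = (\<Sum>t\<in>times \<inter> {0<..T}. \<Sum>j\<in>UNIV. gain j t)"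

definition cross where
  "cross j t = (\<Sum>\<tau>\<in>times \<inter> {last j t<..<t}. \<Sum>k\<in>UNIV.
     joint_share (pre \<tau>) j k * (\<bar>rel j t\<bar> * \<bar>rel k \<tau>\<bar>))"

text \<open>Writing the true excess demand as the estimate minus its error splits the linear term
  into \<open>gain\<close> and an error term; \<open>zt_error\<close> bounds the latter by
  \<open>cross\<close>, a sum over pairs of updates.\<close>

lemma potential_jump:
  assumes "0 < t"
  shows "potential (p t) - potential (pre t) \<le>
    (\<Sum>j\<in>UNIV. 2 * cost j t - gain j t + 37 / 36 * cross j t)"
proof -
  have "potential (p t) - potential (pre t) \<le>
    (\<Sum>j\<in>UNIV. pre t $ j * (2 * total_demand (pre t) j * (rel j t)\<^sup>2 - (total_demand (pre t) j - 1) * rel j t))"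
    by (rule potential_step[OF pre_pos[OF assms] price_step[OF assms] abs_rel_small])
  also have "\<dots> \<le> (\<Sum>j\<in>UNIV. 2 * cost j t - gain j t + 37 / 36 * cross j t)"
  proof (rule sum_mono)
    fix j
    let ?X = "total_demand (pre t) j"
    have pX: "0 \<le> pre t $ j * ?X"
      using pre_pos[OF assms] total_demand_nonneg by (simp add: pos_def less_imp_le)
    show "pre t $ j * (2 * ?X * (rel j t)\<^sup>2 - (?X - 1) * rel j t) \<le> 2 * cost j t - gain j t + 37 / 36 * cross j t"
    proof (cases "t \<in> U j")
      case True
      have "gap j t * gap j t \<le> gap j t" using gap_nonneg[of j t] gap_le[of j t] by (simp add: mult_left_le)
      then have "(lam\<^sup>2 * (clip j t)\<^sup>2 * (pre t $ j * ?X)) * (gap j t * gap j t) \<le>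
          (lam\<^sup>2 * (clip j t)\<^sup>2 * (pre t $ j * ?X)) * gap j t"
        using pX by (intro mult_left_mono) auto
      then have 1: "pre t $ j * ?X * (rel j t)\<^sup>2 \<le> cost j t"
        by (simp add: cost_def rel_def power2_eq_square mult_ac)
      have "\<bar>rel j t\<bar> * (pre t $ j * \<bar>zt j t - (?X - 1)\<bar>) \<le> \<bar>rel j t\<bar> * (37 / 36 *
          (\<Sum>\<tau>\<in>times \<inter> {last j t<..<t}. \<Sum>k\<in>UNIV. joint_share (pre \<tau>) j k * \<bar>rel k \<tau>\<bar>))"
        by (intro mult_left_mono zt_error True) simp
      also have "\<dots> = 37 / 36 * cross j t"
        unfolding cross_def by (simp add: sum_distrib_left mult_ac)
      finally have 2: "pre t $ j * (\<bar>rel j t\<bar> * \<bar>zt j t - (?X - 1)\<bar>) \<le> 37 / 36 * cross j t"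
        by (simp add: mult_ac)
      have "rel j t * (zt j t - (?X - 1)) \<le> \<bar>rel j t\<bar> * \<bar>zt j t - (?X - 1)\<bar>"
        by (metis abs_ge_self abs_mult)
      then have "pre t $ j * (rel j t * (zt j t - (?X - 1))) \<le> pre t $ j * (\<bar>rel j t\<bar> * \<bar>zt j t - (?X - 1)\<bar>)"
        using pre_pos[OF assms] by (intro mult_left_mono) (auto simp: pos_def less_imp_le)
      moreover have "gain j t = pre t $ j * (rel j t * zt j t)"
        by (simp add: gain_def rel_def mult_ac)
      ultimately show ?thesis using 1 2 by (simp add: algebra_simps)
    qed (simp add: rel_eq_0 cost_def gain_def gap_def cross_def)
  qed
  finally show ?thesis .
qed

text \<open>The half of the AM-GM bound on \<open>cross\<close> that carries the square of the
  earlier update's \<open>clip k \<tau>\<close>, and so has to be paid at time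
  \<open>\<tau>\<close>.\<close>

definition forward where
  "forward j t = (\<Sum>\<tau>\<in>times \<inter> {last j t<..<t}. \<Sum>k\<in>UNIV.
     joint_share (pre \<tau>) j k * (lam\<^sup>2 / 2 * gap j t * gap k \<tau> * (clip k \<tau>)\<^sup>2))"

text \<open>The half carrying \<open>clip j t\<close> is paid at \<open>t\<close>. Within the update
  interval joint shares exceed their value at \<open>t\<close> by at most 9/7, the gaps of each
  \<open>k\<close> sum to at most 2, and summing the joint shares over \<open>k\<close> gives the
  spending on \<open>j\<close>: in total 1/2 * 9/7 * 2 times the cost.\<close>

lemma cross_le:
  assumes "0 < t"
  shows "cross j t \<le> 9 / 7 * cost j t + forward j t"
proof (cases "t \<in> U j")
  case True
  have fin: "finite (times \<inter> {last j t<..<t})" by (rule times_finite'[of _ t]) auto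
  have l: "0 \<le> last j t" "last j t < t" using last_facts[OF assms] by auto
  let ?A = "lam\<^sup>2 / 2 * gap j t * (clip j t)\<^sup>2"
  have A: "0 \<le> ?A" using gap_nonneg by simp
  have "cross j t \<le> (\<Sum>\<tau>\<in>times \<inter> {last j t<..<t}. \<Sum>k\<in>UNIV.
      joint_share (pre \<tau>) j k * (?A * gap k \<tau> + lam\<^sup>2 / 2 * gap j t * gap k \<tau> * (clip k \<tau>)\<^sup>2))"
    unfolding cross_def
  proof (intro sum_mono mult_left_mono joint_share_nonneg)
    fix \<tau> k
    have "0 \<le> (\<bar>clip j t\<bar> - \<bar>clip k \<tau>\<bar>)\<^sup>2" by simp
    then have "\<bar>clip j t\<bar> * \<bar>clip k \<tau>\<bar> \<le> ((clip j t)\<^sup>2 + (clip k \<tau>)\<^sup>2) / 2"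
      by (simp add: power2_diff)
    then have "(lam\<^sup>2 * gap j t * gap k \<tau>) * (\<bar>clip j t\<bar> * \<bar>clip k \<tau>\<bar>) \<le>
        (lam\<^sup>2 * gap j t * gap k \<tau>) * (((clip j t)\<^sup>2 + (clip k \<tau>)\<^sup>2) / 2)"
      using gap_nonneg by (intro mult_left_mono) auto
    then show "\<bar>rel j t\<bar> * \<bar>rel k \<tau>\<bar> \<le> ?A * gap k \<tau> + lam\<^sup>2 / 2 * gap j t * gap k \<tau> * (clip k \<tau>)\<^sup>2"
      using lam gap_nonneg[of j t] gap_nonneg[of k \<tau>]
      by (simp add: rel_def abs_mult power2_eq_square algebra_simps)
  qed
  also have "\<dots> = ?A * (\<Sum>\<tau>\<in>times \<inter> {last j t<..<t}. \<Sum>k\<in>UNIV. joint_share (pre \<tau>) j k * gap k \<tau>) + forward j t"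
    unfolding forward_def by (simp only: distrib_left sum.distrib sum_distrib_left mult_ac)
  finally have main: "cross j t \<le> ?A * (\<Sum>\<tau>\<in>times \<inter> {last j t<..<t}. \<Sum>k\<in>UNIV.
      joint_share (pre \<tau>) j k * gap k \<tau>) + forward j t" .
  have "(\<Sum>\<tau>\<in>times \<inter> {last j t<..<t}. \<Sum>k\<in>UNIV. joint_share (pre \<tau>) j k * gap k \<tau>) \<le>
      (\<Sum>\<tau>\<in>times \<inter> {last j t<..<t}. \<Sum>k\<in>UNIV. 9 / 7 * joint_share (pre t) j k * gap k \<tau>)"
    by (intro sum_mono mult_right_mono joint_share_pre_le True gap_nonneg) auto
  also have "\<dots> = (\<Sum>k\<in>UNIV. 9 / 7 * joint_share (pre t) j k * (\<Sum>\<tau>\<in>times \<inter> {last j t<..<t}. gap k \<tau>))"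
    unfolding sum_distrib_left by (rule sum.swap)
  also have "\<dots> \<le> (\<Sum>k\<in>UNIV. 9 / 7 * joint_share (pre t) j k * 2)"
  proof (intro sum_mono mult_left_mono)
    fix k
    have "(\<Sum>\<tau>\<in>times \<inter> {last j t<..<t}. gap k \<tau>) \<le> (\<Sum>\<tau>\<in>times \<inter> {last j t<..t}. gap k \<tau>)"
      by (intro sum_mono2 times_finite'[of _ t] gap_nonneg) auto
    also have "\<dots> = (\<Sum>\<tau>\<in>U k \<inter> {last j t<..t}. gap k \<tau>)"
      by (rule sum_times_eq_sum_updates) (use l in \<open>auto simp: gap_def\<close>)
    also have "\<dots> \<le> 2" using sum_gaps(1)[OF l(1), of t k] l last_plus_one[OF True] by linarith
    finally show "(\<Sum>\<tau>\<in>times \<inter> {last j t<..<t}. gap k \<tau>) \<le> 2" .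
  qed (simp add: joint_share_nonneg)
  also have "\<dots> = 18 / 7 * (pre t $ j * total_demand (pre t) j)"
    unfolding sum_joint_share[OF pre_pos[OF assms], symmetric] sum_distrib_left by simp
  finally have "?A * (\<Sum>\<tau>\<in>times \<inter> {last j t<..<t}. \<Sum>k\<in>UNIV. joint_share (pre \<tau>) j k * gap k \<tau>) \<le>
      ?A * (18 / 7 * (pre t $ j * total_demand (pre t) j))"
    using A by (rule mult_left_mono)
  also have "\<dots> = 9 / 7 * cost j t" by (simp add: cost_def)
  finally show ?thesis using main by linarith
qed (simp add: cross_def rel_eq_0 cost_def gap_def forward_def)

lemma sum_gap_around:
  assumes S: "finite S"
  shows "(\<Sum>t\<in>{t \<in> S. last j t < \<tau> \<and> \<tau> < t}. gap j t) \<le> 1"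
proof -
  let ?S = "{t \<in> S. t \<in> U j \<and> last j t < \<tau> \<and> \<tau> < t}"
  have uniq: "t = t'" if "t \<in> ?S" "t' \<in> ?S" for t t'
  proof -
    have "\<not> t < t'" if "t \<in> ?S" "t' \<in> ?S" for t t'
    proof
      assume "t < t'"
      then have "t \<le> last j t'" using that by (intro last_update_ge update_locally_finite) auto
      then show False using that by auto
    qed
    from this[OF that] this[OF that(2,1)] show ?thesis by simp
  qed
  have "(\<Sum>t\<in>{t \<in> S. last j t < \<tau> \<and> \<tau> < t}. gap j t) = (\<Sum>t\<in>?S. gap j t)"
    by (rule sum.mono_neutral_right) (use S in \<open>auto simp: gap_def\<close>)
  also have "\<dots> \<le> 1"
  proof (cases "?S = {}")
    case False
    then obtain t where "t \<in> ?S" by blast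
    then have "?S = {t}" using uniq by blast
    then show ?thesis using gap_le by simp
  next
    case True
    show ?thesis unfolding True by simp
  qed
  finally show ?thesis .
qed

text \<open>
  The half of each cross term that is charged forward to a later update of price \<open>j\<close>: every
  moment \<open>\<tau>\<close> lies in at most one update interval of \<open>j\<close>, which has length at most one, so
  the charges add up to at most half the cost at \<open>\<tau>\<close>.
\<close>

lemma sum_forward_le:
  fixes T :: real
  defines "S \<equiv> times \<inter> {0<..T}"
  shows "(\<Sum>t\<in>S. \<Sum>j\<in>UNIV. forward j t) \<le> 1 / 2 * (\<Sum>t\<in>S. \<Sum>j\<in>UNIV. cost j t)"
proof -
  have fin: "finite S" unfolding S_def by (rule times_finite'[of _ T]) auto
  let ?f = "\<lambda>j k t \<tau>. joint_share (pre \<tau>) j k * (lam\<^sup>2 / 2 * gap j t * gap k \<tau> * (clip k \<tau>)\<^sup>2)"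
  have fw: "forward j t = (\<Sum>\<tau>\<in>S. if last j t < \<tau> \<and> \<tau> < t then \<Sum>k\<in>UNIV. ?f j k t \<tau> else 0)"
    if "t \<in> S" for j t
  proof -
    have "times \<inter> {last j t<..<t} = {\<tau> \<in> S. last j t < \<tau> \<and> \<tau> < t}"
      using that last_facts(1)[of t j] by (auto simp: S_def)
    then show ?thesis by (simp only: forward_def sum.inter_filter[OF fin])
  qed
  have "(\<Sum>t\<in>S. \<Sum>j\<in>UNIV. forward j t) =
      (\<Sum>t\<in>S. \<Sum>j\<in>UNIV. \<Sum>\<tau>\<in>S. if last j t < \<tau> \<and> \<tau> < t then \<Sum>k\<in>UNIV. ?f j k t \<tau> else 0)"
    by (intro sum.cong refl fw)
  also have "\<dots> = (\<Sum>t\<in>S. \<Sum>\<tau>\<in>S. \<Sum>j\<in>UNIV. if last j t < \<tau> \<and> \<tau> < t then \<Sum>k\<in>UNIV. ?f j k t \<tau> else 0)"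
    by (intro sum.cong refl sum.swap)
  also have "\<dots> = (\<Sum>\<tau>\<in>S. \<Sum>t\<in>S. \<Sum>j\<in>UNIV. if last j t < \<tau> \<and> \<tau> < t then \<Sum>k\<in>UNIV. ?f j k t \<tau> else 0)"
    by (rule sum.swap)
  also have "\<dots> = (\<Sum>\<tau>\<in>S. \<Sum>j\<in>UNIV. \<Sum>t\<in>S. if last j t < \<tau> \<and> \<tau> < t then \<Sum>k\<in>UNIV. ?f j k t \<tau> else 0)"
    by (intro sum.cong refl sum.swap)
  also have "\<dots> = (\<Sum>\<tau>\<in>S. \<Sum>j\<in>UNIV. \<Sum>k\<in>UNIV. \<Sum>t\<in>{t \<in> S. last j t < \<tau> \<and> \<tau> < t}. ?f j k t \<tau>)"
    unfolding sum.inter_filter[OF fin, symmetric] by (intro sum.cong refl sum.swap)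
  also have "\<dots> \<le> (\<Sum>\<tau>\<in>S. \<Sum>j\<in>UNIV. \<Sum>k\<in>UNIV. joint_share (pre \<tau>) j k * (lam\<^sup>2 / 2 * gap k \<tau> * (clip k \<tau>)\<^sup>2))"
  proof (intro sum_mono)
    fix \<tau> j k
    have "(\<Sum>t\<in>{t \<in> S. last j t < \<tau> \<and> \<tau> < t}. ?f j k t \<tau>) =
        joint_share (pre \<tau>) j k * (lam\<^sup>2 / 2 * gap k \<tau> * (clip k \<tau>)\<^sup>2) *
        (\<Sum>t\<in>{t \<in> S. last j t < \<tau> \<and> \<tau> < t}. gap j t)"
      by (simp add: sum_distrib_left mult_ac)
    also have "\<dots> \<le> joint_share (pre \<tau>) j k * (lam\<^sup>2 / 2 * gap k \<tau> * (clip k \<tau>)\<^sup>2) * 1"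
      using gap_nonneg joint_share_nonneg by (intro mult_left_mono sum_gap_around fin) auto
    finally show "(\<Sum>t\<in>{t \<in> S. last j t < \<tau> \<and> \<tau> < t}. ?f j k t \<tau>) \<le>
        joint_share (pre \<tau>) j k * (lam\<^sup>2 / 2 * gap k \<tau> * (clip k \<tau>)\<^sup>2)" by simp
  qed
  also have "\<dots> = (\<Sum>\<tau>\<in>S. \<Sum>k\<in>UNIV. \<Sum>j\<in>UNIV. joint_share (pre \<tau>) j k * (lam\<^sup>2 / 2 * gap k \<tau> * (clip k \<tau>)\<^sup>2))"
    by (intro sum.cong refl sum.swap)
  also have "\<dots> = (\<Sum>\<tau>\<in>S. \<Sum>k\<in>UNIV. 1 / 2 * cost k \<tau>)"
  proof (intro sum.cong refl)
    fix \<tau> k assume "\<tau> \<in> S"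
    then have "pos (pre \<tau>)" by (intro pre_pos) (auto simp: S_def)
    then have "(\<Sum>j\<in>UNIV. joint_share (pre \<tau>) j k) = pre \<tau> $ k * total_demand (pre \<tau>) k"
      using sum_joint_share[of "pre \<tau>" k] by (simp add: joint_share_commute[of _ _ k])
    then show "(\<Sum>j\<in>UNIV. joint_share (pre \<tau>) j k * (lam\<^sup>2 / 2 * gap k \<tau> * (clip k \<tau>)\<^sup>2)) = 1 / 2 * cost k \<tau>"
      unfolding sum_distrib_right[symmetric] by (simp add: cost_def)
  qed
  finally show ?thesis by (simp add: sum_distrib_left)
qed

text \<open>Per unit of cost the losses are 2 from the second-order term, 37/36 * 9/7 = 37/28 from
  the half paid at \<open>t\<close>, and 37/36 * 1/2 from the other half, together less than 4.
  Since 8 costs are covered by the gains, half of the gains survives.\<close>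

lemma potential_descent:
  assumes "0 \<le> T"
  shows "potential (p T) + total_gain T / 2 \<le> potential (p 0)"
proof -
  let ?S = "times \<inter> {0<..T}"
  have pos: "0 < t" if "t \<in> ?S" for t using that by simp
  have "potential (p T) - potential (p 0) = (\<Sum>t\<in>?S. potential (p t) - potential (pre t))"
    by (rule sum_price_jumps) (use assms in auto)
  also have "\<dots> \<le> (\<Sum>t\<in>?S. \<Sum>j\<in>UNIV. 2 * cost j t - gain j t + 37 / 36 * cross j t)"
    by (intro sum_mono potential_jump pos)
  also have "\<dots> \<le> (\<Sum>t\<in>?S. \<Sum>j\<in>UNIV. 2 * cost j t - gain j t + 37 / 36 * (9 / 7 * cost j t + forward j t))"
    by (intro sum_mono add_left_mono mult_left_mono cross_le pos) auto
  also have "\<dots> = (2 + 37 / 28) * (\<Sum>t\<in>?S. \<Sum>j\<in>UNIV. cost j t) - total_gain T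
      + 37 / 36 * (\<Sum>t\<in>?S. \<Sum>j\<in>UNIV. forward j t)"
    unfolding total_gain_def
    by (simp add: sum.distrib sum_subtractf sum_distrib_left sum_divide_distrib distrib_left)
  also have "\<dots> \<le> 4 * (\<Sum>t\<in>?S. \<Sum>j\<in>UNIV. cost j t) - total_gain T"
  proof -
    have "0 \<le> cost j t" if "t \<in> ?S" for j t
      using pre_pos[OF pos[OF that]] gap_nonneg total_demand_nonneg
      by (simp add: cost_def pos_def less_imp_le)
    then have "0 \<le> (\<Sum>t\<in>?S. \<Sum>j\<in>UNIV. cost j t)" by (intro sum_nonneg) auto
    moreover have "(2 + 37 / 28) * C - g + 37 / 36 * F \<le> 4 * C - g" if "0 \<le> C" "F \<le> 1 / 2 * C"
      for C F g :: real
      using that by simp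
    ultimately show ?thesis using sum_forward_le[of T] by blast
  qed
  also have "4 * (\<Sum>t\<in>?S. \<Sum>j\<in>UNIV. cost j t) \<le> total_gain T / 2"
  proof -
    have "(\<Sum>t\<in>?S. \<Sum>j\<in>UNIV. 8 * cost j t) \<le> total_gain T"
      unfolding total_gain_def by (intro sum_mono cost_le_gain pos)
    then show ?thesis by (simp add: sum_distrib_left[symmetric])
  qed
  finally show ?thesis by linarith
qed

end

subsection \<open>Limit points\<close>

context ces_market
begin

section \<open>Coercivity of the potential\<close>

lemma index_le:
  assumes p: "pos p" and i: "i \<in> B"
  shows "e i / c i * ln (index i p) \<le>
    e i / c i * ln (\<Sum>k\<in>UNIV. w i k) + e i * ln (\<Sum>k\<in>UNIV. p $ k)"
proof -
  let ?W = "\<Sum>k\<in>UNIV. w i k" and ?P = "\<Sum>k\<in>UNIV. p $ k"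
  have pk: "0 < p $ k" for k using p by (simp add: pos_def)
  have P: "p $ k \<le> ?P" for k by (rule member_le_sum) (use pk in \<open>auto simp: less_imp_le\<close>)
  have P0: "0 < ?P" using P pk less_le_trans by blast
  obtain k0 where "0 < w i k0" using w_pos[OF i] by blast
  moreover have "w i k0 \<le> ?W" by (rule member_le_sum) (use w_nonneg[OF i] in auto)
  ultimately have W: "0 < ?W" by linarith
  have "index i p \<le> (\<Sum>k\<in>UNIV. w i k * ?P powr c i)"
    unfolding price_index_def
    using c_pos[OF i] pk P by (intro sum_mono mult_left_mono powr_mono2 w_nonneg i) (auto simp: less_imp_le)
  then have "index i p \<le> ?W * ?P powr c i" by (simp add: sum_distrib_right)
  then have "ln (index i p) \<le> ln (?W * ?P powr c i)"
    using index_pos[OF p i] by (intro ln_mono) auto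
  also have "\<dots> = ln ?W + c i * ln ?P" using W P0 by (simp add: ln_mult_pos ln_powr)
  finally have "e i / c i * ln (index i p) \<le> e i / c i * (ln ?W + c i * ln ?P)"
    using e_pos[OF i] c_pos[OF i] by (intro mult_left_mono) auto
  also have "\<dots> = e i / c i * ln ?W + e i * ln ?P" using c_pos[OF i] by (simp add: field_simps)
  finally show ?thesis .
qed

text \<open>The buyers' terms grow like the logarithm of the price sum, against its linear growth in
  the first term. The tangent of \<open>ln\<close> at \<open>2 * (E + 1)\<close> is flat enough for
  total money \<open>E\<close> to use up only half of the linear term.\<close>

lemma potential_coercive:
  obtains C where "\<And>p. pos p \<Longrightarrow> (\<Sum>k\<in>UNIV. p $ k) / 2 \<le> potential p + C"
    and "\<And>p i. pos p \<Longrightarrow> i \<in> B \<Longrightarrow> - (potential p + C) \<le> e i / c i * ln (index i p)"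
proof -
  define E where "E = (\<Sum>i\<in>B. e i)"
  define L where "L = \<bar>ln (2 * (E + 1))\<bar>"
  define K where "K = (\<Sum>i\<in>B. \<bar>e i / c i * ln (\<Sum>k\<in>UNIV. w i k)\<bar>)"
  have E: "0 \<le> E" unfolding E_def using e_pos by (intro sum_nonneg less_imp_le)
  \<comment> \<open>Subsets are allowed because leaving out one buyer bounds that buyer's term from
    below, which keeps each index away from zero.\<close>
  have sub: "(\<Sum>i\<in>B'. e i / c i * ln (index i p)) \<le> (\<Sum>k\<in>UNIV. p $ k) / 2 + (K + E * L)"
    if p: "pos p" and B': "B' \<subseteq> B" for p B'
  proof -
    let ?P = "\<Sum>k\<in>UNIV. p $ k"
    have P: "0 < ?P" using p by (intro sum_pos) (auto simp: pos_def)
    let ?Q = "?P / (2 * (E + 1)) + L"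
    have Q: "0 \<le> ?Q" using P E by (simp add: L_def)
    have "ln (?P / (2 * (E + 1))) \<le> ?P / (2 * (E + 1)) - 1"
      using P E by (intro ln_le_minus_one) auto
    moreover have "ln (?P / (2 * (E + 1))) = ln ?P - ln (2 * (E + 1))"
      using P E by (intro ln_divide_pos) auto
    ultimately have lnP: "ln ?P \<le> ?Q" by (simp add: L_def)
    have "(\<Sum>i\<in>B'. e i / c i * ln (index i p)) \<le>
        (\<Sum>i\<in>B'. \<bar>e i / c i * ln (\<Sum>k\<in>UNIV. w i k)\<bar> + e i * ?Q)"
    proof (rule sum_mono)
      fix i assume "i \<in> B'"
      then have i: "i \<in> B" using B' by blast
      have "e i * ln ?P \<le> e i * ?Q" using e_pos[OF i] lnP by (intro mult_left_mono) auto
      then show "e i / c i * ln (index i p) \<le> \<bar>e i / c i * ln (\<Sum>k\<in>UNIV. w i k)\<bar> + e i * ?Q"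
        using index_le[OF p i] by linarith
    qed
    also have "\<dots> \<le> (\<Sum>i\<in>B. \<bar>e i / c i * ln (\<Sum>k\<in>UNIV. w i k)\<bar> + e i * ?Q)"
      using e_pos Q finite_B B' by (intro sum_mono2) (auto simp: less_imp_le)
    also have "\<dots> = K + E * ?Q" by (simp add: K_def E_def sum.distrib sum_distrib_right)
    also have "E * ?Q \<le> ?P / 2 + E * L"
    proof -
      have "E * (?P / (2 * (E + 1))) \<le> ?P / 2"
        using E P by (simp add: field_simps)
      then show ?thesis by (simp add: distrib_left)
    qed
    finally show ?thesis by linarith
  qed
  show ?thesis
  proof (rule that[of "K + E * L"])
    fix p assume p: "pos p"
    then show "(\<Sum>k\<in>UNIV. p $ k) / 2 \<le> potential p + (K + E * L)"
      using sub[OF p, of B] by (simp add: potential_def)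
    fix i assume i: "i \<in> B"
    have "(\<Sum>i\<in>B. e i / c i * ln (index i p)) =
        e i / c i * ln (index i p) + (\<Sum>i\<in>B - {i}. e i / c i * ln (index i p))"
      using finite_B i by (rule sum.remove)
    moreover have "0 \<le> (\<Sum>k\<in>UNIV. p $ k)" using p by (intro sum_nonneg) (auto simp: pos_def less_imp_le)
    ultimately show "- (potential p + (K + E * L)) \<le> e i / c i * ln (index i p)"
      using sub[OF p, of "B - {i}"] by (simp add: potential_def)
  qed
qed

section \<open>Continuity of demand up to the boundary of the price orthant\<close>

definition orthant :: "(real ^ 'n) set" where "orthant = {x. \<forall>k. 0 \<le> x $ k}"

lemma tendsto_powr_component:
  assumes "i \<in> B"
  shows "((\<lambda>x. (x $ k) powr c i) \<longlongrightarrow> (q $ k) powr c i) (at q within orthant)"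
proof (rule tendsto_powr')
  show "((\<lambda>x. x $ k) \<longlongrightarrow> q $ k) (at q within orthant)" by (intro tendsto_intros)
  have "\<forall>\<^sub>F x in at q within orthant. 0 \<le> x $ k"
    by (auto simp: eventually_at_filter orthant_def)
  then show "q $ k \<noteq> 0 \<or> 0 < c i \<and> (\<forall>\<^sub>F x in at q within orthant. 0 \<le> x $ k)"
    using c_pos[OF assms] by blast
qed auto

lemma tendsto_index:
  "i \<in> B \<Longrightarrow> (index i \<longlongrightarrow> index i q) (at q within orthant)"
  unfolding price_index_def by (intro tendsto_intros tendsto_powr_component)

lemma tendsto_total_demand:
  assumes "\<And>i. i \<in> B \<Longrightarrow> 0 < index i q"
    and "\<And>i. i \<in> B \<Longrightarrow> c i < 1 \<Longrightarrow> 0 < w i j \<Longrightarrow> 0 < q $ j"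
  shows "((\<lambda>x. total_demand x j) \<longlongrightarrow> total_demand q j) (at q within orthant)"
  unfolding total_demand_def
proof (rule tendsto_sum)
  fix i assume i: "i \<in> B"
  show "((\<lambda>x. demand (w i) (c i) (e i) x j) \<longlongrightarrow> demand (w i) (c i) (e i) q j) (at q within orthant)"
  proof (cases "w i j = 0")
    case True
    then show ?thesis by (simp add: demand_def)
  next
    case False
    have "((\<lambda>x. if c i = 1 then 1 else (x $ j) powr (c i - 1)) \<longlongrightarrow>
        (if c i = 1 then 1 else (q $ j) powr (c i - 1))) (at q within orthant)"
    proof (cases "c i = 1")
      case False
      moreover have "0 < q $ j" using assms(2)[OF i] c_le[OF i] w_nonneg[OF i, of j] False \<open>w i j \<noteq> 0\<close> by linarith
      then have "((\<lambda>x. (x $ j) powr (c i - 1)) \<longlongrightarrow> (q $ j) powr (c i - 1)) (at q within orthant)"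
        by (intro tendsto_intros) auto
      ultimately show ?thesis by simp
    qed simp
    then show ?thesis
      unfolding demand_def using assms(1)[OF i]
      by (intro tendsto_intros tendsto_index i) auto
  qed
qed

text \<open>
  On the face of all price vectors with a given support the potential is strictly convex in
  the Leontief price indices, so these are determined at its stationary points.
\<close>

lemma leontief_demand_unique:
  assumes c: "\<And>i. i \<in> B \<Longrightarrow> c i = 1"
    and q: "\<And>j. 0 \<le> q $ j" "\<And>i. i \<in> B \<Longrightarrow> 0 < index i q" "\<And>j. 0 < q $ j \<Longrightarrow> total_demand q j = 1"
    and r: "\<And>j. 0 \<le> r $ j" "\<And>i. i \<in> B \<Longrightarrow> 0 < index i r" "\<And>j. 0 < r $ j \<Longrightarrow> total_demand r j = 1"
    and supp: "\<And>j. 0 < q $ j \<longleftrightarrow> 0 < r $ j"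
  shows "total_demand q j = total_demand r j"
proof -
  have dem: "total_demand x j = (\<Sum>i\<in>B. e i * w i j / index i x)" for x j
    unfolding total_demand_def by (rule sum.cong) (auto simp: demand_def c)
  have idx: "index i x = (\<Sum>k\<in>UNIV. w i k * x $ k)" if "i \<in> B" "\<And>k. 0 \<le> x $ k" for i x
    using that by (simp add: price_index_def c)
  have "(\<Sum>j\<in>UNIV. (q $ j - r $ j) * (total_demand q j - total_demand r j)) = 0"
  proof (rule sum.neutral, rule ballI)
    fix j
    show "(q $ j - r $ j) * (total_demand q j - total_demand r j) = 0"
      using q(1)[of j] q(3)[of j] r(1)[of j] r(3)[of j] supp[of j] by (cases "0 < q $ j") auto
  qed
  \<comment> \<open>The other evaluation, buyer by buyer, gives a nonpositive combination of squared
    index differences, so all of these vanish. Demand depends on prices only through the indices,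
    hence agrees also for goods outside the support.\<close>
  moreover have "(\<Sum>j\<in>UNIV. (q $ j - r $ j) * (total_demand q j - total_demand r j)) =
      (\<Sum>i\<in>B. - (e i * (index i q - index i r)\<^sup>2 / (index i q * index i r)))"
  proof -
    have "(\<Sum>j\<in>UNIV. (q $ j - r $ j) * (total_demand q j - total_demand r j)) =
        (\<Sum>j\<in>UNIV. \<Sum>i\<in>B. (q $ j - r $ j) * (e i * w i j * (1 / index i q - 1 / index i r)))"
      unfolding dem sum_subtractf[symmetric] sum_distrib_left by (simp add: right_diff_distrib)
    also have "\<dots> = (\<Sum>i\<in>B. \<Sum>j\<in>UNIV. (q $ j - r $ j) * (e i * w i j * (1 / index i q - 1 / index i r)))"
      by (rule sum.swap)
    also have "\<dots> = (\<Sum>i\<in>B. e i * (index i q - index i r) * (1 / index i q - 1 / index i r))"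
    proof (rule sum.cong)
      fix i assume i: "i \<in> B"
      have "index i q - index i r = (\<Sum>j\<in>UNIV. w i j * (q $ j - r $ j))"
        unfolding idx[OF i q(1)] idx[OF i r(1)] by (simp add: right_diff_distrib sum_subtractf)
      then show "(\<Sum>j\<in>UNIV. (q $ j - r $ j) * (e i * w i j * (1 / index i q - 1 / index i r))) =
          e i * (index i q - index i r) * (1 / index i q - 1 / index i r)"
        by (simp only: sum_distrib_left sum_distrib_right) (simp add: mult_ac)
    qed simp
    also have "\<dots> = (\<Sum>i\<in>B. - (e i * (index i q - index i r)\<^sup>2 / (index i q * index i r)))"
    proof (rule sum.cong)
      fix i assume i: "i \<in> B"
      show "e i * (index i q - index i r) * (1 / index i q - 1 / index i r) =
          - (e i * (index i q - index i r)\<^sup>2 / (index i q * index i r))"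
        using q(2)[OF i] r(2)[OF i] by (simp add: field_simps power2_eq_square)
    qed simp
    finally show ?thesis .
  qed
  ultimately have "(\<Sum>i\<in>B. e i * (index i q - index i r)\<^sup>2 / (index i q * index i r)) = 0"
    by (simp add: sum_negf)
  moreover have "0 \<le> e i * (index i q - index i r)\<^sup>2 / (index i q * index i r)" if "i \<in> B" for i
    using e_pos[OF that] q(2)[OF that] r(2)[OF that] by (simp add: less_imp_le)
  ultimately have "\<forall>i\<in>B. e i * (index i q - index i r)\<^sup>2 / (index i q * index i r) = 0"
    using finite_B by (subst (asm) sum_nonneg_eq_0_iff) auto
  then have "index i q = index i r" if "i \<in> B" for i
    using e_pos[OF that] q(2)[OF that] r(2)[OF that] that by fastforce
  then show ?thesis unfolding dem by simp
qed

text \<open>The conditions on the index and on desired goods keep the formula for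
  \<open>demand\<close> meaningful at zero prices; they are exactly what
  \<open>has_ces_demand\<close> asks for optimality there.\<close>

definition equilibrium :: "(real ^ 'n) \<Rightarrow> bool" where
  "equilibrium q \<longleftrightarrow> (\<forall>j. 0 \<le> q $ j) \<and> (\<forall>i\<in>B. 0 < index i q) \<and>
     (\<forall>i\<in>B. c i < 1 \<longrightarrow> (\<forall>l. 0 < w i l \<longrightarrow> 0 < q $ l)) \<and>
     (\<forall>j. (0 < q $ j \<longrightarrow> total_demand q j = 1) \<and> (q $ j = 0 \<longrightarrow> total_demand q j \<le> 1))"

end

context ces_tatonnement
begin

section \<open>Summable gains and slow price motion\<close>

lemma total_gain_diff:
  assumes "0 \<le> a" "a \<le> b"
  shows "total_gain b - total_gain a = (\<Sum>t\<in>times \<inter> {a<..b}. \<Sum>j\<in>UNIV. gain j t)"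
proof -
  have "times \<inter> {0<..b} = (times \<inter> {0<..a}) \<union> (times \<inter> {a<..b})" using assms by auto
  moreover have "finite (times \<inter> {0<..a})" "finite (times \<inter> {a<..b})"
    by (rule times_finite'[of _ b], use assms in auto)+
  moreover have "(times \<inter> {0<..a}) \<inter> (times \<inter> {a<..b}) = {}" by auto
  ultimately show ?thesis unfolding total_gain_def by (simp add: sum.union_disjoint)
qed

lemma update_gain_le:
  assumes "0 \<le> a" "a \<le> b"
  shows "(\<Sum>t\<in>U j \<inter> {a<..b}. gain j t) \<le> total_gain b - total_gain a"
proof -
  have "(\<Sum>t\<in>U j \<inter> {a<..b}. gain j t) = (\<Sum>t\<in>times \<inter> {a<..b}. gain j t)"
    by (rule sum_times_eq_sum_updates[symmetric]) (use assms in \<open>auto simp: gain_def gap_def\<close>)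
  also have "\<dots> \<le> (\<Sum>t\<in>times \<inter> {a<..b}. \<Sum>j\<in>UNIV. gain j t)"
  proof (rule sum_mono)
    fix t assume "t \<in> times \<inter> {a<..b}"
    then show "gain j t \<le> (\<Sum>j\<in>UNIV. gain j t)"
      by (intro member_le_sum) (auto intro!: gain_nonneg times_pos)
  qed
  finally show ?thesis using total_gain_diff[OF assms] by simp
qed

lemma total_gain_mono: "0 \<le> a \<Longrightarrow> a \<le> b \<Longrightarrow> total_gain a \<le> total_gain b"
  using total_gain_diff[of a b] sum_nonneg[of "times \<inter> {a<..b}" "\<lambda>t. \<Sum>j\<in>UNIV. gain j t"]
  by (force intro!: sum_nonneg gain_nonneg)

text \<open>All bounds come from combining descent with coercivity:
  \<open>potential (p t) + C\<close> dominates half the price sum and, with half the total gain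
  added, never exceeds its initial value.\<close>

lemma process_bounds:
  obtains M \<eta> G where "0 < M" "\<And>t j. 0 \<le> t \<Longrightarrow> p t $ j \<le> M"
    "\<And>i. i \<in> B \<Longrightarrow> 0 < \<eta> i" "\<And>t i. 0 \<le> t \<Longrightarrow> i \<in> B \<Longrightarrow> \<eta> i \<le> index i (p t)"
    "\<And>t. 0 \<le> t \<Longrightarrow> total_gain t \<le> G"
proof -
  obtain C where C: "\<And>p. pos p \<Longrightarrow> (\<Sum>k\<in>UNIV. p $ k) / 2 \<le> potential p + C"
    "\<And>p i. pos p \<Longrightarrow> i \<in> B \<Longrightarrow> - (potential p + C) \<le> e i / c i * ln (index i p)"
    by (rule potential_coercive) blast
  define D where "D = potential (p 0) + C"
  have gain0: "0 \<le> total_gain t" for t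
    unfolding total_gain_def by (intro sum_nonneg gain_nonneg) auto
  have pot: "potential (p t) + C + total_gain t / 2 \<le> D" if "0 \<le> t" for t
    using potential_descent[OF that] by (simp add: D_def)
  have pk: "p t $ k \<le> (\<Sum>k\<in>UNIV. p t $ k)" if "0 \<le> t" for t k
    by (rule member_le_sum) (use price_pos[OF that] in \<open>auto simp: pos_def less_imp_le\<close>)
  have sum0: "0 < (\<Sum>k\<in>UNIV. p t $ k)" if "0 \<le> t" for t
    using price_pos[OF that] by (intro sum_pos) (auto simp: pos_def)
  show ?thesis
  proof (rule that[of "2 * D" "\<lambda>i. exp (- D * c i / e i)" "2 * D"])
    show "0 < 2 * D" using sum0[of 0] C(1)[OF price_pos[of 0]] pot[of 0] gain0[of 0] by simp
    show "p t $ j \<le> 2 * D" if "0 \<le> t" for t j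
      using pk[OF that, of j] C(1)[OF price_pos[OF that]] pot[OF that] gain0[of t] by linarith
    show "total_gain t \<le> 2 * D" if "0 \<le> t" for t
      using sum0[OF that] C(1)[OF price_pos[OF that]] pot[OF that] by linarith
    show "exp (- D * c i / e i) \<le> index i (p t)" if t: "0 \<le> t" and i: "i \<in> B" for t i
    proof -
      have "- D \<le> e i / c i * ln (index i (p t))"
        using C(2)[OF price_pos[OF t] i] pot[OF t] gain0[of t] by linarith
      then have "- D * c i / e i \<le> ln (index i (p t))"
        using e_pos[OF i] c_pos[OF i] by (simp add: field_simps)
      then show ?thesis
        using index_pos[OF price_pos[OF t] i] by (simp add: ln_ge_iff)
    qed
  qed simp
qed

lemma gain_tail:
  assumes "0 < \<epsilon>"
  obtains T where "0 \<le> T" "\<And>a b j. T \<le> a \<Longrightarrow> a \<le> b \<Longrightarrow> (\<Sum>t\<in>U j \<inter> {a<..b}. gain j t) < \<epsilon>"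
proof -
  obtain G where G: "\<And>t. 0 \<le> t \<Longrightarrow> total_gain t \<le> G" using process_bounds by metis
  let ?S = "total_gain ` {0..}"
  have bdd: "bdd_above ?S" using G by (auto simp: bdd_above_def)
  have "\<exists>y\<in>?S. Sup ?S - \<epsilon> < y" using assms bdd by (subst less_cSup_iff[symmetric]) auto
  then obtain T where T: "0 \<le> T" "Sup ?S - \<epsilon> < total_gain T" by auto
  show ?thesis
  proof (rule that[OF T(1)])
    fix a b j assume ab: "T \<le> a" "a \<le> b"
    have "total_gain b \<le> Sup ?S" using bdd ab T by (intro cSup_upper) auto
    moreover have "total_gain T \<le> total_gain a" using ab T by (intro total_gain_mono) auto
    ultimately show "(\<Sum>t\<in>U j \<inter> {a<..b}. gain j t) < \<epsilon>"
      using update_gain_le[of a b j] T ab by linarith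
  qed
qed

lemma price_jumps:
  assumes "0 \<le> a" "a \<le> b"
  shows "p b $ j - p a $ j = (\<Sum>t\<in>U j \<inter> {a<..b}. pre t $ j * rel j t)"
proof -
  have "p b $ j - p a $ j = (\<Sum>t\<in>times \<inter> {a<..b}. p t $ j - pre t $ j)"
    by (rule sum_price_jumps[OF assms])
  also have "\<dots> = (\<Sum>t\<in>U j \<inter> {a<..b}. p t $ j - pre t $ j)"
    by (rule sum_times_eq_sum_updates) (use assms in \<open>auto simp: price_step rel_eq_0\<close>)
  also have "\<dots> = (\<Sum>t\<in>U j \<inter> {a<..b}. pre t $ j * rel j t)"
    by (rule sum.cong) (use assms in \<open>auto simp: price_step algebra_simps\<close>)
  finally show ?thesis .
qed

text \<open>Displacement is linear in \<open>clip\<close> but gain is quadratic for small estimates,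
  so a small gain alone does not bound it. AM-GM trades a term proportional to elapsed time against
  a multiple of the gain.\<close>

lemma slow_component:
  assumes "0 < \<epsilon>"
  obtains T where "0 \<le> T"
    "\<And>a b. T \<le> a \<Longrightarrow> a \<le> b \<Longrightarrow> b \<le> a + 3 \<Longrightarrow> \<bar>p b $ j - p a $ j\<bar> < \<epsilon>"
proof -
  obtain M where M: "0 < M" "\<And>t j. 0 \<le> t \<Longrightarrow> p t $ j \<le> M" using process_bounds by metis
  \<comment> \<open>Over three days the gaps sum to at most 4, so this choice makes the time term
    exactly \<epsilon> / 2; a gain below \<open>2 * \<kappa> * \<epsilon>\<close> leaves the
    rest.\<close>
  define \<kappa> where "\<kappa> = \<epsilon> / (8 * M * lam)"
  have k: "0 < \<kappa>" using assms M lam by (simp add: \<kappa>_def)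
  obtain T where T: "0 \<le> T" "\<And>a b j. T \<le> a \<Longrightarrow> a \<le> b \<Longrightarrow> (\<Sum>t\<in>U j \<inter> {a<..b}. gain j t) < 2 * \<kappa> * \<epsilon>"
    using gain_tail[of "2 * \<kappa> * \<epsilon>"] assms k by auto
  show ?thesis
  proof (rule that[OF T(1)])
    fix a b :: real assume ab: "T \<le> a" "a \<le> b" "b \<le> a + 3"
    have a0: "0 \<le> a" using ab T by linarith
    have "\<bar>p b $ j - p a $ j\<bar> \<le> (\<Sum>t\<in>U j \<inter> {a<..b}. \<bar>pre t $ j * rel j t\<bar>)"
      unfolding price_jumps[OF a0 ab(2)] by (rule sum_abs)
    also have "\<dots> \<le> (\<Sum>t\<in>U j \<inter> {a<..b}. \<kappa> * M * lam * gap j t + gain j t / (4 * \<kappa>))"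
    proof (rule sum_mono)
      fix t assume "t \<in> U j \<inter> {a<..b}"
      then have t: "0 < t" using a0 by auto
      have pj: "0 \<le> pre t $ j" "pre t $ j \<le> M"
        using pre_pos[OF t] M(2)[OF last_facts(1)[OF t]] by (auto simp: pos_def pre_def less_imp_le)
      have "0 \<le> (2 * \<kappa> - \<bar>clip j t\<bar>)\<^sup>2" by simp
      then have "4 * \<kappa> * \<bar>clip j t\<bar> \<le> 4 * \<kappa>\<^sup>2 + (clip j t)\<^sup>2" by (simp add: power2_diff)
      moreover have "(clip j t)\<^sup>2 \<le> clip j t * zt j t"
        by (auto simp: clip_def min_def power2_eq_square)
      ultimately have "\<bar>clip j t\<bar> \<le> \<kappa> + clip j t * zt j t / (4 * \<kappa>)"
        using k by (simp add: field_simps power2_eq_square)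
      then have "(pre t $ j * lam * gap j t) * \<bar>clip j t\<bar> \<le>
          (pre t $ j * lam * gap j t) * (\<kappa> + clip j t * zt j t / (4 * \<kappa>))"
        using pj lam gap_nonneg by (intro mult_left_mono) auto
      also have "\<dots> = pre t $ j * (\<kappa> * lam * gap j t) + gain j t / (4 * \<kappa>)"
        by (simp add: gain_def algebra_simps)
      also have "pre t $ j * (\<kappa> * lam * gap j t) \<le> M * (\<kappa> * lam * gap j t)"
        using pj k lam gap_nonneg by (intro mult_right_mono) auto
      finally show "\<bar>pre t $ j * rel j t\<bar> \<le> \<kappa> * M * lam * gap j t + gain j t / (4 * \<kappa>)"
        using pj lam gap_nonneg[of j t] by (simp add: rel_def abs_mult mult_ac)
    qed
    also have "\<dots> = \<kappa> * M * lam * (\<Sum>t\<in>U j \<inter> {a<..b}. gap j t) + (\<Sum>t\<in>U j \<inter> {a<..b}. gain j t) / (4 * \<kappa>)"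
      by (simp add: sum.distrib sum_distrib_left sum_divide_distrib)
    also have "\<dots> < \<kappa> * M * lam * 4 + (2 * \<kappa> * \<epsilon>) / (4 * \<kappa>)"
    proof (rule add_le_less_mono)
      show "\<kappa> * M * lam * (\<Sum>t\<in>U j \<inter> {a<..b}. gap j t) \<le> \<kappa> * M * lam * 4"
        using sum_gaps(1)[OF a0 ab(2), of j] ab k M lam by (intro mult_left_mono) auto
      show "(\<Sum>t\<in>U j \<inter> {a<..b}. gain j t) / (4 * \<kappa>) < (2 * \<kappa> * \<epsilon>) / (4 * \<kappa>)"
        using T(2)[OF ab(1,2)] k by (intro divide_strict_right_mono) auto
    qed
    also have "\<dots> = \<epsilon>" using k M lam assms by (simp add: \<kappa>_def field_simps)
    finally show "\<bar>p b $ j - p a $ j\<bar> < \<epsilon>" .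
  qed
qed

lemma slow_motion:
  assumes "0 < \<epsilon>"
  obtains T where "0 \<le> T" "\<And>a b. T \<le> a \<Longrightarrow> a \<le> b \<Longrightarrow> b \<le> a + 3 \<Longrightarrow> dist (p b) (p a) < \<epsilon>"
proof -
  define d where "d = \<epsilon> / real CARD('n)"
  have d: "0 < d" using assms by (simp add: d_def)
  have "\<exists>T. \<forall>j. 0 \<le> T j \<and> (\<forall>a b. T j \<le> a \<longrightarrow> a \<le> b \<longrightarrow> b \<le> a + 3 \<longrightarrow> \<bar>p b $ j - p a $ j\<bar> < d)"
    by (rule choice) (use slow_component[OF d] in metis)
  then obtain T where T: "\<And>j. 0 \<le> T j"
    "\<And>j a b. T j \<le> a \<Longrightarrow> a \<le> b \<Longrightarrow> b \<le> a + 3 \<Longrightarrow> \<bar>p b $ j - p a $ j\<bar> < d" by blast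
  show ?thesis
  proof (rule that[of "\<Sum>j\<in>UNIV. T j"])
    show "0 \<le> (\<Sum>j\<in>UNIV. T j)" using T(1) by (intro sum_nonneg)
    fix a b assume ab: "(\<Sum>j\<in>UNIV. T j) \<le> a" "a \<le> b" "b \<le> a + 3"
    have "T j \<le> (\<Sum>j\<in>UNIV. T j)" for j by (rule member_le_sum) (use T(1) in auto)
    then have "\<bar>p b $ j - p a $ j\<bar> < d" for j using T(2)[of j a b] ab by (meson order_trans)
    then have "(\<Sum>j\<in>UNIV. \<bar>(p b - p a) $ j\<bar>) < (\<Sum>j\<in>(UNIV :: 'n set). d)"
      by (intro sum_strict_mono) auto
    then show "dist (p b) (p a) < \<epsilon>"
      using norm_le_l1_cart[of "p b - p a"] by (simp add: dist_norm d_def)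
  qed
qed

section \<open>Limit points of the trajectory\<close>

definition limit_along :: "(nat \<Rightarrow> real) \<Rightarrow> real ^ 'n \<Rightarrow> bool" where
  "limit_along \<tau> q \<longleftrightarrow> (\<forall>n. real n \<le> \<tau> n) \<and> (\<lambda>n. p (\<tau> n)) \<longlonglongrightarrow> q"

lemma limit_along_subseq:
  assumes "\<And>n. real n \<le> \<tau> n"
  obtains r q where "strict_mono r" "limit_along (\<lambda>n. \<tau> (r n)) q"
proof -
  obtain M where M: "0 < M" "\<And>t j. 0 \<le> t \<Longrightarrow> p t $ j \<le> M" using process_bounds by metis
  have t0: "0 \<le> \<tau> n" for n using assms[of n] by (meson of_nat_0_le_iff order_trans)
  have "norm (p (\<tau> n)) \<le> real CARD('n) * M" for n
  proof -
    have "norm (p (\<tau> n)) \<le> (\<Sum>j\<in>UNIV. \<bar>p (\<tau> n) $ j\<bar>)" by (rule norm_le_l1_cart)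
    also have "\<dots> \<le> (\<Sum>j\<in>(UNIV :: 'n set). M)"
      using M(2)[OF t0] price_pos[OF t0] by (intro sum_mono) (auto simp: pos_def less_imp_le)
    finally show ?thesis by simp
  qed
  then have "bounded (range (\<lambda>n. p (\<tau> n)))" by (auto simp: bounded_iff)
  then obtain q r where r: "strict_mono r" "((\<lambda>n. p (\<tau> n)) \<circ> r) \<longlonglongrightarrow> q"
    using bounded_imp_convergent_subsequence by blast
  have "real n \<le> \<tau> (r n)" for n
    using assms[of "r n"] seq_suble[OF r(1), of n] by linarith
  then show ?thesis using that[OF r(1)] r(2) by (auto simp: limit_along_def o_def)
qed

text \<open>Compactness: if \<open>P\<close> failed at arbitrarily late times, a convergent
  subsequence of the failures would contradict the assumption. One good index per sequence suffices
  because every sequence is covered.\<close>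

lemma eventually_from_limits:
  assumes "\<And>\<tau> q. limit_along \<tau> q \<Longrightarrow> \<exists>n. P (\<tau> n)"
  obtains T where "0 \<le> T" "\<And>t. T \<le> t \<Longrightarrow> P t"
proof -
  have "\<exists>T\<ge>0. \<forall>t\<ge>T. P t"
  proof (rule ccontr)
    assume "\<not> (\<exists>T\<ge>0. \<forall>t\<ge>T. P t)"
    then have "\<forall>n. \<exists>t. real n \<le> t \<and> \<not> P t" by (meson of_nat_0_le_iff)
    then obtain \<tau> where \<tau>: "\<And>n. real n \<le> \<tau> n" "\<And>n. \<not> P (\<tau> n)" by metis
    then show False using limit_along_subseq[of \<tau>] assms by metis
  qed
  then show ?thesis using that by blast
qed

lemma limit_along_eventually:
  assumes "limit_along \<tau> q" "0 < \<delta>"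
  shows "\<forall>\<^sub>F n in sequentially. \<forall>s. \<tau> n \<le> s \<longrightarrow> s \<le> \<tau> n + 3 \<longrightarrow> dist (p s) q < \<delta>"
proof -
  obtain T where T: "0 \<le> T" "\<And>a b. T \<le> a \<Longrightarrow> a \<le> b \<Longrightarrow> b \<le> a + 3 \<Longrightarrow> dist (p b) (p a) < \<delta> / 2"
    using slow_motion[of "\<delta> / 2"] assms(2) by auto
  have "\<forall>\<^sub>F n in sequentially. T \<le> real n" using filterlim_real_sequentially by (simp add: filterlim_at_top)
  moreover have "\<forall>\<^sub>F n in sequentially. dist (p (\<tau> n)) q < \<delta> / 2"
    using assms by (intro tendstoD) (auto simp: limit_along_def)
  ultimately show ?thesis
  proof eventually_elim
    case (elim n)
    have "T \<le> \<tau> n" using elim(1) assms(1) unfolding limit_along_def by (meson order_trans)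
    then have "dist (p s) (p (\<tau> n)) < \<delta> / 2" if "\<tau> n \<le> s" "s \<le> \<tau> n + 3" for s
      using T(2) that by blast
    then show ?case using elim(2) by (metis dist_triangle_half_r dist_commute)
  qed
qed

lemma limit_along_nonneg_time: "limit_along \<tau> q \<Longrightarrow> 0 \<le> \<tau> n"
  unfolding limit_along_def by (meson of_nat_0_le_iff order_trans)

lemma limit_nonneg:
  assumes "limit_along \<tau> q"
  shows "0 \<le> q $ j"
proof -
  have "(\<lambda>n. p (\<tau> n) $ j) \<longlonglongrightarrow> q $ j"
    using assms unfolding limit_along_def by (intro tendsto_intros) auto
  then show ?thesis
    using price_pos[OF limit_along_nonneg_time[OF assms]]
    by (intro LIMSEQ_le_const) (auto simp: pos_def less_imp_le)
qed

lemma tendsto_along_limit: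
  assumes l: "limit_along \<tau> q" and f: "(f \<longlongrightarrow> f q) (at q within orthant)"
  shows "(\<lambda>n. f (p (\<tau> n))) \<longlonglongrightarrow> f q"
proof -
  have "continuous (at q within orthant) f" using f by (simp add: continuous_within)
  moreover have "p (\<tau> n) \<in> orthant" for n
    using price_pos[OF limit_along_nonneg_time[OF l]] by (auto simp: orthant_def pos_def less_imp_le)
  ultimately show ?thesis
    using l by (intro continuous_within_tendsto_compose'[of q orthant f]) (auto simp: limit_along_def)
qed

lemma limit_index_pos:
  assumes l: "limit_along \<tau> q" and i: "i \<in> B"
  shows "0 < index i q"
proof -
  obtain \<eta> where \<eta>: "\<And>i. i \<in> B \<Longrightarrow> 0 < \<eta> i" "\<And>t i. 0 \<le> t \<Longrightarrow> i \<in> B \<Longrightarrow> \<eta> i \<le> index i (p t)"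
    using process_bounds by metis
  have "\<eta> i \<le> index i q"
    using \<eta>(2)[OF limit_along_nonneg_time[OF l] i]
    by (intro LIMSEQ_le_const[OF tendsto_along_limit[OF l tendsto_index[OF i]]]) auto
  then show ?thesis using \<eta>(1)[OF i] by linarith
qed

lemma demand_near_limit:
  assumes l: "limit_along \<tau> q" and \<epsilon>: "0 < \<epsilon>"
    and "\<And>i. i \<in> B \<Longrightarrow> c i < 1 \<Longrightarrow> 0 < w i j \<Longrightarrow> 0 < q $ j"
  shows "\<forall>\<^sub>F n in sequentially. \<forall>s. \<tau> n \<le> s \<longrightarrow> s \<le> \<tau> n + 3 \<longrightarrow>
    \<bar>total_demand (p s) j - total_demand q j\<bar> < \<epsilon>"
proof -
  have "\<forall>\<^sub>F x in at q within orthant. dist (total_demand x j) (total_demand q j) < \<epsilon>"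
    using tendsto_total_demand[OF limit_index_pos[OF l] assms(3)] \<epsilon> by (rule tendstoD)
  then obtain \<delta> where \<delta>: "0 < \<delta>"
    "\<And>x. x \<in> orthant \<Longrightarrow> x \<noteq> q \<Longrightarrow> dist x q < \<delta> \<Longrightarrow> dist (total_demand x j) (total_demand q j) < \<epsilon>"
    by (auto simp: eventually_at)
  show ?thesis using limit_along_eventually[OF l \<delta>(1)]
  proof eventually_elim
    case (elim n)
    show ?case
    proof (intro allI impI)
      fix s assume s: "\<tau> n \<le> s" "s \<le> \<tau> n + 3"
      then have "0 \<le> s" using limit_along_nonneg_time[OF l, of n] by linarith
      then have "p s \<in> orthant" using price_pos[of s] by (auto simp: orthant_def pos_def less_imp_le)
      then show "\<bar>total_demand (p s) j - total_demand q j\<bar> < \<epsilon>"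
        using \<delta>(2)[of "p s"] elim s \<epsilon> by (cases "p s = q") (auto simp: dist_real_def)
    qed
  qed
qed

text \<open>Updates after \<open>a + 1\<close> have intervals starting no earlier than
  \<open>a\<close>, so their estimates share the sign and size of the excess demand. The remaining
  two days have gaps summing to at least 1, which explains the window of length 3.\<close>

lemma window_gain:
  assumes a: "0 \<le> a" and m: "0 < m" and b: "0 < b" "b \<le> 1"
    and price: "\<And>s. a \<le> s \<Longrightarrow> s \<le> a + 3 \<Longrightarrow> m \<le> p s $ j"
    and dem: "(\<forall>s. a \<le> s \<longrightarrow> s \<le> a + 3 \<longrightarrow> b \<le> total_demand (p s) j - 1) \<or>
      (\<forall>s. a \<le> s \<longrightarrow> s \<le> a + 3 \<longrightarrow> total_demand (p s) j - 1 \<le> - b)"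
  shows "m * lam * b\<^sup>2 \<le> (\<Sum>t\<in>U j \<inter> {a + 1<..a + 3}. gain j t)"
proof -
  have "m * lam * b\<^sup>2 * 1 \<le> m * lam * b\<^sup>2 * (\<Sum>t\<in>U j \<inter> {a + 1<..a + 3}. gap j t)"
    using sum_gaps(2)[of "a + 1" "a + 3" j] a m lam by (intro mult_left_mono) auto
  also have "\<dots> = (\<Sum>t\<in>U j \<inter> {a + 1<..a + 3}. m * lam * b\<^sup>2 * gap j t)"
    by (simp add: sum_distrib_left)
  also have "\<dots> \<le> (\<Sum>t\<in>U j \<inter> {a + 1<..a + 3}. gain j t)"
  proof (rule sum_mono)
    fix t assume "t \<in> U j \<inter> {a + 1<..a + 3}"
    then have t: "t \<in> U j" "a + 1 < t" "t \<le> a + 3" "0 < t" using a by auto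
    have l: "a \<le> last j t" "last j t < t" using last_plus_one[OF t(1)] last_facts(2)[OF t(4)] t by auto
    have pm: "m \<le> pre t $ j" using price[of "last j t"] l t by (simp add: pre_def)
    have "b \<le> zt j t \<or> zt j t \<le> - b"
      using dem
    proof
      assume h: "\<forall>s. a \<le> s \<longrightarrow> s \<le> a + 3 \<longrightarrow> b \<le> total_demand (p s) j - 1"
      obtain s where s: "last j t < s" "s < t" "total_demand (p s) j - 1 \<le> zt j t"
        using zt_lower[OF t(1)] by blast
      then have "b \<le> total_demand (p s) j - 1" using h l t by auto
      then show ?thesis using s(3) by linarith
    next
      assume h: "\<forall>s. a \<le> s \<longrightarrow> s \<le> a + 3 \<longrightarrow> total_demand (p s) j - 1 \<le> - b"
      obtain s where s: "last j t < s" "s < t" "zt j t \<le> total_demand (p s) j - 1"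
        using zt_upper[OF t(1)] by blast
      then have "total_demand (p s) j - 1 \<le> - b" using h l t by auto
      then show ?thesis using s(3) by linarith
    qed
    then have "b * b \<le> clip j t * zt j t"
    proof
      assume "b \<le> zt j t"
      then show ?thesis using b by (intro mult_mono) (auto simp: clip_def)
    next
      assume "zt j t \<le> - b"
      then have "b * b \<le> (- clip j t) * (- zt j t)" using b by (intro mult_mono) (auto simp: clip_def)
      then show ?thesis by simp
    qed
    then have "m * (lam * gap j t) * b\<^sup>2 \<le> pre t $ j * (lam * gap j t) * (clip j t * zt j t)"
      using pm m lam gap_nonneg by (intro mult_mono) (auto simp: power2_eq_square)
    then show "m * lam * b\<^sup>2 * gap j t \<le> gain j t" by (simp add: gain_def mult_ac)
  qed
  finally show ?thesis by simp
qed

text \<open>Otherwise slow motion would keep price and excess demand away from zero on whole windows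
  arbitrarily late, each contributing a fixed gain, against \<open>gain_tail\<close>.\<close>

lemma limit_stationary:
  assumes l: "limit_along \<tau> q" and qj: "0 < q $ j"
  shows "total_demand q j = 1"
proof (rule ccontr)
  assume ne: "total_demand q j \<noteq> 1"
  define b where "b = min (\<bar>total_demand q j - 1\<bar> / 2) 1"
  have b: "0 < b" "b \<le> 1" "2 * b \<le> \<bar>total_demand q j - 1\<bar>" using ne by (auto simp: b_def min_def)
  define m where "m = q $ j / 2"
  have m: "0 < m" using qj by (simp add: m_def)
  obtain T where T: "0 \<le> T" "\<And>a b' j. T \<le> a \<Longrightarrow> a \<le> b' \<Longrightarrow> (\<Sum>t\<in>U j \<inter> {a<..b'}. gain j t) < m * lam * b\<^sup>2"
    using gain_tail[of "m * lam * b\<^sup>2"] m lam b by auto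
  have "\<forall>\<^sub>F n in sequentially. T \<le> real n" using filterlim_real_sequentially by (simp add: filterlim_at_top)
  moreover have "\<forall>\<^sub>F n in sequentially. \<forall>s. \<tau> n \<le> s \<longrightarrow> s \<le> \<tau> n + 3 \<longrightarrow>
      \<bar>total_demand (p s) j - total_demand q j\<bar> < b"
    by (rule demand_near_limit[OF l b(1)]) (rule qj)
  ultimately have "\<forall>\<^sub>F n in sequentially. False"
    using limit_along_eventually[OF l m]
  proof eventually_elim
    case (elim n)
    have Tn: "T \<le> \<tau> n" using elim(1) l unfolding limit_along_def by (meson order_trans)
    have "m \<le> p s $ j" if "\<tau> n \<le> s" "s \<le> \<tau> n + 3" for s
      using elim(3) that component_le_norm_cart[of "p s - q" j] by (force simp: m_def dist_norm)
    moreover have near: "\<bar>total_demand (p s) j - total_demand q j\<bar> < b" if "\<tau> n \<le> s" "s \<le> \<tau> n + 3" for s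
      using elim(2) that by blast
    have "(\<forall>s. \<tau> n \<le> s \<longrightarrow> s \<le> \<tau> n + 3 \<longrightarrow> b \<le> total_demand (p s) j - 1) \<or>
      (\<forall>s. \<tau> n \<le> s \<longrightarrow> s \<le> \<tau> n + 3 \<longrightarrow> total_demand (p s) j - 1 \<le> - b)"
      using near b(3) by (smt (verit))
    ultimately have "m * lam * b\<^sup>2 \<le> (\<Sum>t\<in>U j \<inter> {\<tau> n + 1<..\<tau> n + 3}. gain j t)"
      using limit_along_nonneg_time[OF l] m b by (intro window_gain) auto
    then show False using T(2)[of "\<tau> n + 1" "\<tau> n + 3" j] Tn by linarith
  qed
  then show False by simp
qed

text \<open>Prices are bounded, so the buyer's index is too, and for \<open>c i < 1\<close> demand
  reaches 1 once price \<open>j\<close> is at most \<open>m0\<close>. Below \<open>m0\<close>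
  updates never lower it, and an update from above \<open>m0\<close> ends at no less than 36/37 of
  \<open>m0\<close>.\<close>

lemma desired_price_bounded_below:
  assumes i: "i \<in> B" and c1: "c i < 1" and wj: "0 < w i j"
  obtains m where "0 < m" "\<And>t. 0 \<le> t \<Longrightarrow> m \<le> p t $ j"
proof -
  obtain M where M: "0 < M" "\<And>t j. 0 \<le> t \<Longrightarrow> p t $ j \<le> M" using process_bounds by metis
  define K where "K = e i * w i j / (\<Sum>k\<in>UNIV. w i k * M powr c i)"
  have "0 < (\<Sum>k\<in>UNIV. w i k * M powr c i)"
    using wj w_nonneg[OF i] M by (intro sum_pos2[of _ j]) auto
  then have K: "0 < K" using e_pos[OF i] wj by (simp add: K_def)
  define m0 where "m0 = K powr (1 / (1 - c i))"
  have m0: "0 < m0" using K by (simp add: m0_def)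
  have m0K: "K * m0 powr (c i - 1) = 1"
  proof -
    have "1 / (1 - c i) * (c i - 1) = - 1" using c1 by (simp add: field_simps)
    then show ?thesis using K by (simp add: m0_def powr_powr powr_minus)
  qed
  have high: "1 \<le> total_demand (p s) j" if s: "0 \<le> s" "p s $ j \<le> m0" for s
  proof -
    have ps: "0 < p s $ k" for k using price_pos[OF s(1)] by (simp add: pos_def)
    have "1 = e i * w i j * m0 powr (c i - 1) / (\<Sum>k\<in>UNIV. w i k * M powr c i)"
      using m0K by (metis K_def times_divide_eq_left)
    also have "\<dots> \<le> e i * w i j * (p s $ j) powr (c i - 1) / index i (p s)"
    proof (rule frac_le)
      show "e i * w i j * m0 powr (c i - 1) \<le> e i * w i j * (p s $ j) powr (c i - 1)"
        using e_pos[OF i] wj ps[of j] s(2) c1 by (intro mult_left_mono powr_mono2') auto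
      show "index i (p s) \<le> (\<Sum>k\<in>UNIV. w i k * M powr c i)"
        unfolding price_index_def using c_pos[OF i] ps M(2)[OF s(1)]
        by (intro sum_mono mult_left_mono powr_mono2 w_nonneg i) (auto simp: less_imp_le)
    qed (use e_pos[OF i] wj index_pos[OF price_pos[OF s(1)] i] in auto)
    also have "\<dots> = demand (w i) (c i) (e i) (p s) j" using c1 by (simp add: demand_def)
    also have "\<dots> \<le> total_demand (p s) j"
      unfolding total_demand_def using finite_B i
      by (intro member_le_sum) (auto intro!: demand_nonneg w_nonneg less_imp_le[OF e_pos])
    finally show ?thesis .
  qed
  define m where "m = min (p 0 $ j) (m0 * (36 / 37))"
  show ?thesis
  proof (rule that[of m])
    show "0 < m" using m0 price_pos[of 0] by (simp add: m_def pos_def)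
    fix t :: real assume "0 \<le> t"
    then show "m \<le> p t $ j"
    proof (induction "card (U j \<inter> {..t})" arbitrary: t rule: less_induct)
      case less
      show ?case
      proof (cases "U j \<inter> {..t} = {}")
        case True
        then have "p t $ j = p 0 $ j" using less.prems by (intro price_constant) auto
        then show ?thesis by (simp add: m_def)
      next
        case False
        define v where "v = Max (U j \<inter> {..t})"
        have v: "v \<in> U j" "v \<le> t"
          using Max_in[OF update_locally_finite False] by (auto simp: v_def)
        have v0: "0 < v" using v update_pos by auto
        have "U j \<inter> {v<..t} = {}"
          using Max_ge[OF update_locally_finite[of j t]] by (force simp: v_def)
        then have pt: "p t $ j = p v $ j" using v v0 by (intro price_constant) auto
        have l: "0 \<le> last j v" "last j v < v" using last_facts[OF v0] by auto
        have "v \<in> U j \<inter> {..t}" "v \<notin> U j \<inter> {..last j v}" "U j \<inter> {..last j v} \<subseteq> U j \<inter> {..t}"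
          using v l by auto
        then have "U j \<inter> {..last j v} \<subset> U j \<inter> {..t}" by blast
        then have "card (U j \<inter> {..last j v}) < card (U j \<inter> {..t})"
          by (rule psubset_card_mono[OF update_locally_finite])
        then have IH: "m \<le> p (last j v) $ j" using l by (intro less.hyps)
        have step: "p v $ j = p (last j v) $ j * (1 + rel j v)"
          using price_step[OF v0, of j] by (simp add: pre_def)
        have plast: "0 < p (last j v) $ j" using price_pos[OF l(1)] by (simp add: pos_def)
        show ?thesis
        proof (cases "p (last j v) $ j \<le> m0")
          case True
          obtain s where s: "last j v < s" "s < v" "total_demand (p s) j - 1 \<le> zt j v"
            using zt_lower[OF v(1)] by blast
          have "p s $ j = p (last j v) $ j" using price_eq_last[OF v0, of j s] s by (simp add: pre_def)
          then have "0 \<le> zt j v" using high[of s] s l True by simp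
          then have "0 \<le> rel j v" using lam gap_nonneg by (simp add: rel_def clip_def)
          then have "p (last j v) $ j \<le> p v $ j" using plast by (simp add: step)
          then show ?thesis using IH pt by linarith
        next
          case False
          have "36 / 37 \<le> 1 + rel j v" using abs_rel_small[of j v] by (simp add: abs_le_iff)
          then have "m0 * (36 / 37) \<le> p v $ j"
            unfolding step using False m0 by (intro mult_mono) auto
          then show ?thesis using pt by (simp add: m_def)
        qed
      qed
    qed
  qed
qed

lemma limit_equilibrium_ces:
  assumes l: "limit_along \<tau> q" and c1: "\<And>i. i \<in> B \<Longrightarrow> c i < 1"
  shows "equilibrium q"
proof -
  have desired: "0 < q $ j" if i: "i \<in> B" and w: "0 < w i j" for i j
  proof -
    obtain m where m: "0 < m" "\<And>t. 0 \<le> t \<Longrightarrow> m \<le> p t $ j"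
      using desired_price_bounded_below[OF i c1[OF i] w] by blast
    have "(\<lambda>n. p (\<tau> n) $ j) \<longlonglongrightarrow> q $ j"
      using l unfolding limit_along_def by (intro tendsto_intros) auto
    then have "m \<le> q $ j"
      using m(2)[OF limit_along_nonneg_time[OF l]] by (intro LIMSEQ_le_const) auto
    then show ?thesis using m by linarith
  qed
  have "total_demand q j \<le> 1" if "q $ j = 0" for j
  proof -
    have "w i j = 0" if "i \<in> B" for i
      using desired[OF that, of j] w_nonneg[OF that, of j] \<open>q $ j = 0\<close> by force
    then have "total_demand q j = 0" by (simp add: total_demand_def demand_def)
    then show ?thesis by simp
  qed
  then show ?thesis
    using limit_nonneg[OF l] limit_index_pos[OF l] limit_stationary[OF l] desired
    by (auto simp: equilibrium_def)
qed

text \<open>A limit price of zero with demand above 1 is contradicted by trapping the demand above 1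
  from some time on: the price, being positive, would then be nondecreasing.\<close>

lemma limit_equilibrium_leontief:
  assumes l: "limit_along \<tau> q" and c1: "\<And>i. i \<in> B \<Longrightarrow> c i = 1"
  shows "equilibrium q"
proof -
  have "total_demand q j \<le> 1" if qj: "q $ j = 0" for j
  proof (rule ccontr)
    assume "\<not> total_demand q j \<le> 1"
    then have big: "1 < total_demand q j" by simp
    define L where "L = {q. \<exists>\<tau>. limit_along \<tau> q}"
    have "finite ((\<lambda>q. total_demand q j) ` L)"
    proof -
      define supp where "supp = (\<lambda>x :: real ^ 'n. {k. 0 < x $ k})"
      have L: "0 \<le> x $ k" "i \<in> B \<Longrightarrow> 0 < index i x" "0 < x $ k \<Longrightarrow> total_demand x k = 1"
        if "x \<in> L" for x k i
        using that by (auto simp: L_def intro: limit_nonneg limit_index_pos limit_stationary)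
      have "total_demand x j = total_demand y j" if "x \<in> L" "y \<in> L" "supp x = supp y" for x y
        using that(3)
        by (intro leontief_demand_unique[OF c1 L[OF that(1)] L[OF that(2)]]) (auto simp: supp_def set_eq_iff)
      then have "(\<lambda>q. total_demand q j) ` L \<subseteq>
          (\<lambda>S. total_demand (SOME x. x \<in> L \<and> supp x = S) j) ` UNIV"
      proof (intro subsetI, elim imageE)
        fix v x assume h: "v = total_demand x j" "x \<in> L"
        let ?y = "SOME y. y \<in> L \<and> supp y = supp x"
        have "?y \<in> L \<and> supp ?y = supp x" by (rule someI[of _ x]) (use h in auto)
        then have "v = total_demand ?y j"
          using h \<open>\<And>x y. x \<in> L \<Longrightarrow> y \<in> L \<Longrightarrow> supp x = supp y \<Longrightarrow> total_demand x j = total_demand y j\<close> by metis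
        then show "v \<in> (\<lambda>S. total_demand (SOME x. x \<in> L \<and> supp x = S) j) ` UNIV" by blast
      qed
      then show ?thesis by (rule finite_subset) simp
    qed
    \<comment> \<open>Inserting 1 makes the set nonempty and ensures that demand above
      \<open>\<mu>\<close> means positive excess demand.\<close>
    then have fin: "finite (insert 1 {v \<in> (\<lambda>q. total_demand q j) ` L. v < total_demand q j})" (is "finite ?V")
      by simp
    define \<mu> where "\<mu> = Max ?V"
    have mu: "1 \<le> \<mu>" "\<mu> < total_demand q j" "\<And>x. x \<in> L \<Longrightarrow> total_demand x j < total_demand q j \<Longrightarrow> total_demand x j \<le> \<mu>"
      using Max_in[OF fin] Max_ge[OF fin] big by (auto simp: \<mu>_def)
    \<comment> \<open>No limit value lies strictly between \<open>\<mu>\<close> and the demand at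
      \<open>q\<close>. The middle third of this gap is eventually avoided, and later moves of less
      than its width \<open>d\<close> cannot cross it.\<close>
    define d where "d = (total_demand q j - \<mu>) / 3"
    have d: "0 < d" using mu by (simp add: d_def)
    define \<theta> where "\<theta> = \<mu> + 2 * d"
    have gap_free: "\<bar>total_demand x j - (\<mu> + 3 / 2 * d)\<bar> > d" if "x \<in> L" for x
      using mu(3)[OF that] d by (cases "total_demand x j < total_demand q j") (auto simp: d_def abs_if field_simps)
    have near: "\<forall>\<^sub>F n in sequentially. \<forall>s. \<tau>' n \<le> s \<longrightarrow> s \<le> \<tau>' n + 3 \<longrightarrow>
        \<bar>total_demand (p s) j - total_demand q' j\<bar> < \<epsilon>" if "limit_along \<tau>' q'" "0 < \<epsilon>" for \<tau>' q' \<epsilon>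
      by (rule demand_near_limit[OF that]) (use c1 in force)
    obtain T1 where T1: "0 \<le> T1" "\<And>t. T1 \<le> t \<Longrightarrow> \<not> (\<mu> + d \<le> total_demand (p t) j \<and> total_demand (p t) j \<le> \<theta>)"
    proof (rule eventually_from_limits[where P = "\<lambda>t. \<not> (\<mu> + d \<le> total_demand (p t) j \<and> total_demand (p t) j \<le> \<theta>)"])
      fix \<tau>' q' assume l': "limit_along \<tau>' q'"
      have "q' \<in> L" using l' by (auto simp: L_def)
      from gap_free[OF this] obtain n where "\<bar>total_demand (p (\<tau>' n)) j - total_demand q' j\<bar> < d / 2"
        using near[OF l', of "d / 2"] d by (force simp: eventually_sequentially)
      then have "\<not> (\<mu> + d \<le> total_demand (p (\<tau>' n)) j \<and> total_demand (p (\<tau>' n)) j \<le> \<theta>)"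
        using gap_free[OF \<open>q' \<in> L\<close>] d unfolding \<theta>_def
        by (auto simp: abs_if field_simps split: if_splits)
      then show "\<exists>n. \<not> (\<mu> + d \<le> total_demand (p (\<tau>' n)) j \<and> total_demand (p (\<tau>' n)) j \<le> \<theta>)" by blast
    qed blast
    obtain T2 where T2: "0 \<le> T2" "\<And>t. T2 \<le> t \<Longrightarrow>
        \<forall>s. t \<le> s \<longrightarrow> s \<le> t + 3 \<longrightarrow> \<bar>total_demand (p s) j - total_demand (p t) j\<bar> < d"
    proof (rule eventually_from_limits[where P = "\<lambda>t. \<forall>s. t \<le> s \<longrightarrow> s \<le> t + 3 \<longrightarrow> \<bar>total_demand (p s) j - total_demand (p t) j\<bar> < d"])
      fix \<tau>' q' assume l': "limit_along \<tau>' q'"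
      obtain n where n: "\<And>s. \<tau>' n \<le> s \<Longrightarrow> s \<le> \<tau>' n + 3 \<Longrightarrow> \<bar>total_demand (p s) j - total_demand q' j\<bar> < d / 2"
        using near[OF l', of "d / 2"] d by (force simp: eventually_sequentially)
      have "\<bar>total_demand (p s) j - total_demand (p (\<tau>' n)) j\<bar> < d" if "\<tau>' n \<le> s" "s \<le> \<tau>' n + 3" for s
        using n[OF that] n[of "\<tau>' n"] by (smt (verit) field_sum_of_halves)
      then show "\<exists>n. \<forall>s. \<tau>' n \<le> s \<longrightarrow> s \<le> \<tau>' n + 3 \<longrightarrow> \<bar>total_demand (p s) j - total_demand (p (\<tau>' n)) j\<bar> < d"
        by blast
    qed blast
    have "\<forall>\<^sub>F n in sequentially. max T1 T2 \<le> real n"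
      using filterlim_real_sequentially unfolding filterlim_at_top by blast
    then have "\<forall>\<^sub>F n in sequentially. max T1 T2 \<le> \<tau> n \<and> \<theta> < total_demand (p (\<tau> n)) j"
      using near[OF l d]
    proof eventually_elim
      case (elim n)
      have "max T1 T2 \<le> \<tau> n" using elim(1) l unfolding limit_along_def by (meson order_trans)
      moreover have "\<bar>total_demand (p (\<tau> n)) j - total_demand q j\<bar> < d" using elim(2) by simp
      ultimately show ?case using d by (auto simp: \<theta>_def d_def abs_if field_simps split: if_splits)
    qed
    then obtain a where a: "T1 \<le> a" "T2 \<le> a" "\<theta> < total_demand (p a) j"
      by (auto simp: eventually_sequentially)
    have a0: "0 \<le> a" using a T1 by linarith
    have stay: "\<theta> < total_demand (p t) j" if "a \<le> t" "t \<le> a + real k" for t k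
      using that
    proof (induction k arbitrary: t)
      case 0
      then show ?case using a by simp
    next
      case (Suc k)
      define t' where "t' = max a (t - 1)"
      have t': "a \<le> t'" "t' \<le> a + real k" "t' \<le> t" "t \<le> t' + 3" using Suc.prems by (auto simp: t'_def)
      have "\<bar>total_demand (p t) j - total_demand (p t') j\<bar> < d" using T2(2)[of t'] t' a by auto
      then have "\<mu> + d < total_demand (p t) j"
        using Suc.IH[OF t'(1,2)] by (simp add: \<theta>_def)
      then show ?case using T1(2)[of t] Suc.prems a by auto
    qed
    have high: "1 \<le> total_demand (p t) j" if "a \<le> t" for t
    proof -
      obtain k where "t - a \<le> real k" using real_arch_simple by blast
      then have "\<theta> < total_demand (p t) j" using stay[OF that, of k] by simp
      then show ?thesis using mu(1) d by (simp add: \<theta>_def)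
    qed
    \<comment> \<open>Starting at \<open>a + 1\<close> keeps the whole interval of each estimate
      after \<open>a\<close>, where demand is known to be high.\<close>
    have incr: "p (a + 1) $ j \<le> p t $ j" if "a + 1 \<le> t" for t
    proof -
      have "0 \<le> (\<Sum>v\<in>U j \<inter> {a + 1<..t}. pre v $ j * rel j v)"
      proof (rule sum_nonneg)
        fix v assume "v \<in> U j \<inter> {a + 1<..t}"
        then have v: "v \<in> U j" "a + 1 < v" "0 < v" using a0 by auto
        obtain s where s: "last j v < s" "s < v" "total_demand (p s) j - 1 \<le> zt j v"
          using zt_lower[OF v(1)] by blast
        then have "0 \<le> zt j v" using high[of s] last_plus_one[OF v(1)] v by linarith
        then show "0 \<le> pre v $ j * rel j v"
          using lam gap_nonneg pre_pos[OF v(3)] by (simp add: rel_def clip_def pos_def less_imp_le)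
      qed
      then show ?thesis using price_jumps[of "a + 1" t j] a0 that by simp
    qed
    have "(\<lambda>n. p (\<tau> n) $ j) \<longlonglongrightarrow> q $ j"
      using l unfolding limit_along_def by (intro tendsto_intros) auto
    moreover have "\<forall>\<^sub>F n in sequentially. p (a + 1) $ j \<le> p (\<tau> n) $ j"
    proof -
      have "\<forall>\<^sub>F n in sequentially. a + 1 \<le> real n" using filterlim_real_sequentially by (simp add: filterlim_at_top)
      then show ?thesis
      proof eventually_elim
        case (elim n)
        then show ?case using l incr unfolding limit_along_def by (meson order_trans)
      qed
    qed
    ultimately have "p (a + 1) $ j \<le> q $ j" by (rule tendsto_lowerbound) simp
    moreover have "0 < p (a + 1) $ j" using price_pos[of "a + 1"] a0 by (simp add: pos_def)
    ultimately show False using qj by linarith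
  qed
  then show ?thesis
    using limit_nonneg[OF l] limit_index_pos[OF l] limit_stationary[OF l] c1
    by (auto simp: equilibrium_def)
qed

lemma convergence:
  assumes "(\<forall>i\<in>B. c i < 1) \<or> (\<forall>i\<in>B. c i = 1)" and A: "\<And>q. equilibrium q \<Longrightarrow> q \<in> A"
  shows "A \<noteq> {}" "((\<lambda>t. infdist (p t) A) \<longlongrightarrow> 0) at_top"
proof -
  \<comment> \<open>Boundedness supplies some limit point, so equilibria exist. This must be shown
    separately, since \<open>infdist\<close> to the empty set is 0 and convergence alone would be
    vacuous.\<close>
  have lim: "q \<in> A" if "limit_along \<tau> q" for \<tau> q
    using assms(1) limit_equilibrium_ces[OF that] limit_equilibrium_leontief[OF that] A by blast
  show "A \<noteq> {}" using limit_along_subseq[of real] lim by blast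
  show "((\<lambda>t. infdist (p t) A) \<longlongrightarrow> 0) at_top"
  proof (rule tendstoI)
    fix \<epsilon> :: real assume \<epsilon>: "0 < \<epsilon>"
    obtain T where "0 \<le> T" "\<And>t. T \<le> t \<Longrightarrow> infdist (p t) A < \<epsilon>"
    proof (rule eventually_from_limits[where P = "\<lambda>t. infdist (p t) A < \<epsilon>"])
      fix \<tau> q assume l: "limit_along \<tau> q"
      then obtain n where "dist (p (\<tau> n)) q < \<epsilon>"
        using tendstoD[of "\<lambda>n. p (\<tau> n)" q sequentially, OF _ \<epsilon>]
        by (auto simp: limit_along_def eventually_sequentially)
      then show "\<exists>n. infdist (p (\<tau> n)) A < \<epsilon>"
        using infdist_le[OF lim[OF l]] order.strict_trans1 by blast
    qed blast
    then show "\<forall>\<^sub>F t in at_top. dist (infdist (p t) A) 0 < \<epsilon>"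
      by (auto simp: eventually_at_top_linorder dist_real_def infdist_nonneg)
  qed
qed

end

subsection \<open>Convergence\<close>

lemma excess_demands_singleton:
  assumes e: "\<And>i. i \<in> B \<Longrightarrow> 0 < e i"
    and D: "\<And>i. i \<in> B \<Longrightarrow> has_ces_demand (w i) (c i) (u i)"
    and p: "\<And>k. 0 < p $ k"
  shows "excess_demands B e u p = {\<chi> j. (\<Sum>i\<in>B. demand (w i) (c i) (e i) p j) - 1}"
proof -
  have o: "optimal_bundles (u i) (e i) p = {\<chi> j. demand (w i) (c i) (e i) p j}" if "i \<in> B" for i
    using D[OF that] e[OF that] p unfolding has_ces_demand_def by blast
  show ?thesis
  proof (intro equalityI subsetI)
    fix z assume "z \<in> excess_demands B e u p"
    then obtain x where "\<And>i. i \<in> B \<Longrightarrow> x i = (\<chi> j. demand (w i) (c i) (e i) p j)"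
      and "\<And>j. z $ j = (\<Sum>i\<in>B. x i $ j) - 1"
      using o by (auto simp: excess_demands_def)
    then show "z \<in> {\<chi> j. (\<Sum>i\<in>B. demand (w i) (c i) (e i) p j) - 1}"
      by (simp add: vec_eq_iff)
  next
    fix z assume "z \<in> {\<chi> j. (\<Sum>i\<in>B. demand (w i) (c i) (e i) p j) - 1}"
    then show "z \<in> excess_demands B e u p"
      unfolding excess_demands_def
      by (auto simp: o intro!: exI[of _ "\<lambda>i. \<chi> j. demand (w i) (c i) (e i) p j"])
  qed
qed

text \<open>There is an apparent circle: the bounds on \<open>zt\<close> make sense only when demand
  is unique, hence at positive prices, and positivity after an update needs
  \<open>zt \<ge> -1\<close>. The bounds are therefore first derived from positivity strictly before
  \<open>t\<close>, and positivity then follows by induction on the number of update times.\<close>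

lemma tatonnement_is_ces:
  fixes u :: "'b \<Rightarrow> real ^ 'n::finite \<Rightarrow> real"
  assumes finB: "finite B" and e: "\<And>i. i \<in> B \<Longrightarrow> 0 < e i"
    and D: "\<And>i. i \<in> B \<Longrightarrow> has_ces_demand (w i) (c i) (u i)"
    and lam: "0 < lam" "lam \<le> 1 / 37"
    and T: "asynchronous_tatonnement B e u lam U zt p"
  shows "ces_tatonnement B e w c lam U zt p"
proof -
  interpret T: asynchronous_tatonnement B e u lam U zt p by (rule T)
  interpret M: ces_market B e w c
    by unfold_locales (use finB e D in \<open>auto simp: has_ces_demand_def\<close>)
  define times where "times = (\<Union>j. U j)"
  have fin: "finite (times \<inter> {..t})" for t
  proof -
    have "finite (\<Union>j. U j \<inter> {..t})" by (intro finite_UN_I T.update_locally_finite) simp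
    then show ?thesis by (rule rev_finite_subset) (auto simp: times_def)
  qed
  have times_pos: "times \<subseteq> {0<..}" using T.update_pos by (auto simp: times_def)
  have last_bounds: "0 \<le> last_update (U j) t" "last_update (U j) t < t" if "t \<in> U j" for j t
    using last_update_cases[OF T.update_locally_finite T.update_pos, of t j] T.update_pos[of j] that by auto
  \<comment> \<open>Only finitely many price vectors occur up to a given time, so \<open>Min\<close>
    and \<open>Max\<close> are attained at actual moments of the interval.\<close>
  have price_values: "p s \<in> p ` insert 0 (times \<inter> {..s})" if "0 \<le> s" for s
  proof -
    have fin': "finite (insert 0 (times \<inter> {..s}))" using fin by simp
    define v where "v = Max (insert 0 (times \<inter> {..s}))"
    have v: "v \<in> insert 0 (times \<inter> {..s})" unfolding v_def by (rule Max_in[OF fin']) simp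
    then have vs: "0 \<le> v" "v \<le> s" using that times_pos by auto
    have "times \<inter> {v<..s} = {}" using Max_ge[OF fin'] by (force simp: v_def)
    then have "p s $ j = p v $ j" for j
      using vs by (intro T.price_constant) (auto simp: times_def)
    then have "p s = p v" by (simp add: vec_eq_iff)
    then show ?thesis using v by blast
  qed
  have zt: "(\<exists>s. last_update (U j) t < s \<and> s < t \<and> M.total_demand (p s) j - 1 \<le> zt j t) \<and>
      (\<exists>s. last_update (U j) t < s \<and> s < t \<and> zt j t \<le> M.total_demand (p s) j - 1)"
    if t: "t \<in> U j" and pos: "\<And>s k. 0 \<le> s \<Longrightarrow> s < t \<Longrightarrow> 0 < p s $ k" for t j
  proof -
    let ?I = "{last_update (U j) t<..<t}"
    let ?Z = "{z $ j | z s. s \<in> ?I \<and> z \<in> excess_demands B e u (p s)}"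
    have "excess_demands B e u (p s) = {\<chi> j. M.total_demand (p s) j - 1}" if "s \<in> ?I" for s
      unfolding M.total_demand_def
      by (rule excess_demands_singleton) (use e D pos last_bounds(1)[OF t] that in auto)
    then have Z: "?Z = (\<lambda>s. M.total_demand (p s) j - 1) ` ?I" by force
    have "?Z \<subseteq> (\<lambda>x. M.total_demand x j - 1) ` p ` insert 0 (times \<inter> {..t})"
    proof -
      have "p s \<in> p ` insert 0 (times \<inter> {..t})" if "s \<in> ?I" for s
        using price_values[of s] last_bounds(1)[OF t] that by auto
      then show ?thesis unfolding Z by blast
    qed
    then have finZ: "finite ?Z" by (rule finite_subset) (simp add: fin)
    have "?I \<noteq> {}" using last_bounds(2)[OF t] dense by auto
    then have ne: "?Z \<noteq> {}" unfolding Z by blast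
    have "Min ?Z \<in> ?Z" "Max ?Z \<in> ?Z" by (rule Min_in[OF finZ ne], rule Max_in[OF finZ ne])
    then obtain s1 s2 where "s1 \<in> ?I" "Min ?Z = M.total_demand (p s1) j - 1"
      "s2 \<in> ?I" "Max ?Z = M.total_demand (p s2) j - 1"
      unfolding Z by (elim imageE) blast
    then show ?thesis using T.zt_lower[OF t] T.zt_upper[OF t] by auto
  qed
  have pos: "0 < p t $ j" if "0 \<le> t" for t j
    using that
  proof (induction "card (times \<inter> {..t})" arbitrary: t j rule: less_induct)
    case less
    have IH: "0 < p s $ k" if "0 \<le> s" "s < v" "v \<in> times" "v \<le> t" for s k v
    proof -
      have "v \<in> times \<inter> {..t}" "v \<notin> times \<inter> {..s}" "times \<inter> {..s} \<subseteq> times \<inter> {..t}"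
        using that by auto
      then have "times \<inter> {..s} \<subset> times \<inter> {..t}" by blast
      then have "card (times \<inter> {..s}) < card (times \<inter> {..t})" by (rule psubset_card_mono[OF fin])
      then show ?thesis using that(1) by (rule less.hyps)
    qed
    show ?case
    proof (cases "U j \<inter> {..t} = {}")
      case True
      then have "p t $ j = p 0 $ j" using less.prems by (intro T.price_constant) auto
      then show ?thesis using T.initial_pos by simp
    next
      case False
      define v where "v = Max (U j \<inter> {..t})"
      have v: "v \<in> U j" "v \<le> t" using Max_in[OF T.update_locally_finite False] by (auto simp: v_def)
      have vt: "v \<in> times" using v by (auto simp: times_def)
      have "U j \<inter> {v<..t} = {}"
        using Max_ge[OF T.update_locally_finite[of j t]] by (force simp: v_def)
      then have pt: "p t $ j = p v $ j"
        using v times_pos vt by (intro T.price_constant) auto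
      define g where "g = v - last_update (U j) v"
      obtain s where s: "s \<in> U j" "last_update (U j) v < s" "s \<le> last_update (U j) v + 1"
        using T.update_daily[OF last_bounds(1)[OF v(1)], of j] by auto
      have "v \<le> s"
        using last_update_cases(3)[OF T.update_locally_finite T.update_pos, of v j] times_pos vt s
        by (force simp: not_less[symmetric])
      then have g: "0 < g" "g \<le> 1" using s last_bounds(2)[OF v(1)] by (auto simp: g_def)
      obtain s' where "M.total_demand (p s') j - 1 \<le> zt j v"
        using zt[OF v(1)] IH[OF _ _ vt v(2)] by blast
      then have z: "-1 \<le> min (zt j v) 1" using M.total_demand_nonneg[of "p s'" j] by simp
      have "lam * g < 1"
        using mult_mono[OF lam(2) g(2)] g lam by simp
      moreover have "(lam * g) * (-1) \<le> (lam * g) * min (zt j v) 1"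
        using g lam z by (intro mult_left_mono) auto
      ultimately have "0 < 1 + lam * min (zt j v) 1 * g" by (simp add: mult_ac)
      moreover have "0 < p (last_update (U j) v) $ j"
        using IH[OF last_bounds[OF v(1)] vt v(2)] .
      ultimately show ?thesis unfolding pt T.update[OF v(1)] g_def[symmetric] by (rule mult_pos_pos[rotated])
    qed
  qed
  show ?thesis
  proof unfold_locales
    show "\<exists>s. last_update (U j) t < s \<and> s < t \<and> M.total_demand (p s) j - 1 \<le> zt j t" if "t \<in> U j" for j t
      using zt[OF that] pos by blast
    show "\<exists>s. last_update (U j) t < s \<and> s < t \<and> zt j t \<le> M.total_demand (p s) j - 1" if "t \<in> U j" for j t
      using zt[OF that] pos by blast
    show "M.pos (p t)" if "0 \<le> t" for t using pos[OF that] by (simp add: M.pos_def)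
  qed (fact lam T.update_pos T.update_locally_finite T.update_daily T.price_constant T.update)+
qed

theorem theorem5:
  fixes B :: "'b set"
    and e :: "'b \<Rightarrow> real"
    and u :: "'b \<Rightarrow> real ^ 'n::finite \<Rightarrow> real"
    and lam :: real
    and U :: "'n \<Rightarrow> real set"
    and zt :: "'n \<Rightarrow> real \<Rightarrow> real"
    and p :: "real \<Rightarrow> real ^ 'n"
  assumes "finite B"
    and "\<And>i. i \<in> B \<Longrightarrow> 0 < e i"
    and "(\<forall>i\<in>B. complementary_ces (u i)) \<or> (\<forall>i\<in>B. leontief (u i))"
    and "0 < lam" and "lam \<le> 1 / 37"
    and "asynchronous_tatonnement B e u lam U zt p"
  shows "market_equilibria B e u \<noteq> {} \<and>
    ((\<lambda>t. infdist (p t) (market_equilibria B e u)) \<longlongrightarrow> 0) at_top"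
proof -
  obtain w c where D: "\<And>i. i \<in> B \<Longrightarrow> has_ces_demand (w i) (c i) (u i)"
    and c: "(\<forall>i\<in>B. c i < 1) \<or> (\<forall>i\<in>B. c i = 1)"
    using assms(3)
  proof
    assume "\<forall>i\<in>B. complementary_ces (u i)"
    then have "\<forall>i\<in>B. \<exists>wc. snd wc < 1 \<and> has_ces_demand (fst wc) (snd wc) (u i)"
      using complementary_ces_has_ces_demand by fastforce
    then obtain wc where "\<forall>i\<in>B. snd (wc i) < 1 \<and> has_ces_demand (fst (wc i)) (snd (wc i)) (u i)"
      by metis
    then show thesis using that[of "\<lambda>i. fst (wc i)" "\<lambda>i. snd (wc i)"] by auto
  next
    assume "\<forall>i\<in>B. leontief (u i)"
    then have "\<forall>i\<in>B. \<exists>w. has_ces_demand w 1 (u i)" using leontief_has_ces_demand by blast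
    from bchoice[OF this] obtain w where "\<forall>i\<in>B. has_ces_demand (w i) 1 (u i)" by blast
    then show thesis using that[of w "\<lambda>_. 1"] by auto
  qed
  interpret ces_tatonnement B e w c lam U zt p
    by (rule tatonnement_is_ces[OF assms(1,2) D assms(4,5,6)])
  have "q \<in> market_equilibria B e u" if q: "equilibrium q" for q
  proof -
    let ?x = "\<lambda>i. \<chi> j. demand (w i) (c i) (e i) q j"
    have "?x i \<in> optimal_bundles (u i) (e i) q" if "i \<in> B" for i
      using D[OF that] assms(2)[OF that] q that unfolding has_ces_demand_def equilibrium_def by blast
    then have "(\<chi> j. total_demand q j - 1) \<in> excess_demands B e u q"
      unfolding excess_demands_def total_demand_def by (auto intro!: exI[of _ ?x])
    then show ?thesis
      using q unfolding market_equilibria_def equilibrium_def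
      by (auto intro!: bexI[of _ "\<chi> j. total_demand q j - 1"])
  qed
  then show ?thesis using convergence[OF c, of "market_equilibria B e u"] by blast
qed

end
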